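(* There exists $a=(a_n)_{n\ge0}\in\ell^2(\mathbb N_0)$ for which the trace norms of the rectangular coordinate compressions of the matrix $\mathcal P(a)=[a_{r+u}W(r,u)]_{r,u\ge0}$ are unbounded; equivalently, \[ \sup_{\substack{I,U\subset\mathbb N_0\\ I,U\ \mathrm{finite}}}\big\|[a_{r+u}W(r,u)]_{r\in I,\,u\in U}\big\|_1=\infty . \] In particular, the formal correspondence $a\mapsto\mathcal P(a)$, initially specified through its finite coordinate compressions, does not extend to a bounded map $\ell^2(\mathbb N_0)\to\mathcal S_1$; i.e. there is no bounded linear map $\ell^2(\mathbb N_0)\to\mathcal S_1$ sending each $a$ to an operator whose $(r,u)$ matrix entries are $a_{r+u}W(r,u)$.
   Context: $\mathbb N_0=\{0,1,2,\dots\}$. For $r,u\in\mathbb N_0$, \[ W(r,u)=2^{-(2r+u+2)}\binom{2r+u+1}{r}\sqrt{\frac{r+u+1}{r+1}} . \] For a sequence $a=(a_n)_{n\ge0}$ of complex numbers, the Pascal-weighted Hankel matrix is $\mathcal P(a)(r,u)=a_{r+u}W(r,u)$. $\|\cdot\|_1$ is the trace norm, $\mathcal S_1$ is the space of trace class operators on $\ell^2(\mathbb N_0)$, and finite rectangular matrices are regarded as operators on $\ell^2(\mathbb N_0)$ by extending them by zero. *)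

theory Defs
  imports "HOL-Analysis.Analysis"
begin

section \<open>Bounded operators on complex \<open>\<ell>\<^sup>2(\<nat>\<^sub>0)\<close>\<close>

text \<open>
  Operators are HOL functions on all sequences, but only their values on \<open>ell2\<close> matter:
  every notion below quantifies over \<open>ell2\<close> only.
\<close>

definition ell2 :: "(nat \<Rightarrow> complex) set" where
  "ell2 = {x. summable (\<lambda>n. (cmod (x n))\<^sup>2)}"

definition ell2_norm :: "(nat \<Rightarrow> complex) \<Rightarrow> real" where
  "ell2_norm x = sqrt (\<Sum>n. (cmod (x n))\<^sup>2)"

definition ell2_inner :: "(nat \<Rightarrow> complex) \<Rightarrow> (nat \<Rightarrow> complex) \<Rightarrow> complex" where
  "ell2_inner x y = (\<Sum>n. x n * cnj (y n))"

definition basis_vec :: "nat \<Rightarrow> nat \<Rightarrow> complex" where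
  "basis_vec n = (\<lambda>k. if k = n then 1 else 0)"

definition bounded_op :: "((nat \<Rightarrow> complex) \<Rightarrow> (nat \<Rightarrow> complex)) \<Rightarrow> bool" where
  "bounded_op T \<longleftrightarrow>
     (\<forall>x\<in>ell2. T x \<in> ell2) \<and>
     (\<forall>x\<in>ell2. \<forall>y\<in>ell2. T (\<lambda>n. x n + y n) = (\<lambda>n. T x n + T y n)) \<and>
     (\<forall>c. \<forall>x\<in>ell2. T (\<lambda>n. c * x n) = (\<lambda>n. c * T x n)) \<and>
     (\<exists>C\<ge>0. \<forall>x\<in>ell2. ell2_norm (T x) \<le> C * ell2_norm x)"

definition positive_op :: "((nat \<Rightarrow> complex) \<Rightarrow> (nat \<Rightarrow> complex)) \<Rightarrow> bool" where
  "positive_op P \<longleftrightarrow> bounded_op P \<and> (\<forall>x\<in>ell2. ell2_inner (P x) x \<in> \<real>\<^sub>\<ge>\<^sub>0)"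

section \<open>Trace norm and trace class\<close>

text \<open>
  \<open>is_abs_op T P\<close> says \<open>P = |T| = (T\<^sup>*T)\<^sup>1\<^sup>/\<^sup>2\<close>, i.e. \<open>P\<close> is positive and \<open>P\<^sup>2 = T\<^sup>*T\<close>; the latter is
  written weakly, using \<open>\<langle>T\<^sup>*T x, y\<rangle> = \<langle>T x, T y\<rangle>\<close>. For a bounded \<open>T\<close> such a \<open>P\<close> exists and its
  restriction to \<open>ell2\<close> is unique, so the choice in \<open>abs_op\<close> is immaterial.
\<close>

definition is_abs_op ::
  "((nat \<Rightarrow> complex) \<Rightarrow> (nat \<Rightarrow> complex)) \<Rightarrow> ((nat \<Rightarrow> complex) \<Rightarrow> (nat \<Rightarrow> complex)) \<Rightarrow> bool" where
  "is_abs_op T P \<longleftrightarrow> positive_op P \<and>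
     (\<forall>x\<in>ell2. \<forall>y\<in>ell2. ell2_inner (P (P x)) y = ell2_inner (T x) (T y))"

definition abs_op ::
  "((nat \<Rightarrow> complex) \<Rightarrow> (nat \<Rightarrow> complex)) \<Rightarrow> ((nat \<Rightarrow> complex) \<Rightarrow> (nat \<Rightarrow> complex))" where
  "abs_op T = (SOME P. is_abs_op T P)"

text \<open>\<open>\<parallel>T\<parallel>\<^sub>1 = tr |T|\<close>, with value \<open>\<infinity>\<close> if the bounded operator \<open>T\<close> is not of trace class.\<close>

definition trace_norm :: "((nat \<Rightarrow> complex) \<Rightarrow> (nat \<Rightarrow> complex)) \<Rightarrow> ennreal" where
  "trace_norm T = (\<Sum>n. ennreal (Re (ell2_inner (abs_op T (basis_vec n)) (basis_vec n))))"

definition trace_class :: "((nat \<Rightarrow> complex) \<Rightarrow> (nat \<Rightarrow> complex)) set" where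
  "trace_class = {T. bounded_op T \<and> trace_norm T < \<infinity>}"

definition bounded_linear_into_trace_class ::
  "((nat \<Rightarrow> complex) \<Rightarrow> ((nat \<Rightarrow> complex) \<Rightarrow> (nat \<Rightarrow> complex))) \<Rightarrow> bool" where
  "bounded_linear_into_trace_class \<Phi> \<longleftrightarrow>
     (\<forall>a\<in>ell2. \<Phi> a \<in> trace_class) \<and>
     (\<forall>a\<in>ell2. \<forall>b\<in>ell2. \<forall>x\<in>ell2. \<Phi> (\<lambda>n. a n + b n) x = (\<lambda>n. \<Phi> a x n + \<Phi> b x n)) \<and>
     (\<forall>c. \<forall>a\<in>ell2. \<forall>x\<in>ell2. \<Phi> (\<lambda>n. c * a n) x = (\<lambda>n. c * \<Phi> a x n)) \<and>
     (\<exists>C\<ge>0. \<forall>a\<in>ell2. trace_norm (\<Phi> a) \<le> ennreal (C * ell2_norm a))"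

section \<open>Matrices\<close>

definition op_entry :: "((nat \<Rightarrow> complex) \<Rightarrow> (nat \<Rightarrow> complex)) \<Rightarrow> nat \<Rightarrow> nat \<Rightarrow> complex" where
  "op_entry T r u = ell2_inner (T (basis_vec u)) (basis_vec r)"

text \<open>
  The rectangular block \<open>[M r u]\<close>, \<open>r \<in> I\<close>, \<open>u \<in> U\<close>, extended by zero to an operator;
  used only for finite \<open>I\<close> and \<open>U\<close>.
\<close>

definition block_op ::
  "(nat \<Rightarrow> nat \<Rightarrow> complex) \<Rightarrow> nat set \<Rightarrow> nat set \<Rightarrow> (nat \<Rightarrow> complex) \<Rightarrow> (nat \<Rightarrow> complex)" where
  "block_op M I U x = (\<lambda>r. if r \<in> I then (\<Sum>u\<in>U. M r u * x u) else 0)"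

definition W :: "nat \<Rightarrow> nat \<Rightarrow> real" where
  "W r u = 1 / 2 ^ (2 * r + u + 2) * real ((2 * r + u + 1) choose r) *
     sqrt (real (r + u + 1) / real (r + 1))"

definition pascal_hankel :: "(nat \<Rightarrow> complex) \<Rightarrow> nat \<Rightarrow> nat \<Rightarrow> complex" where
  "pascal_hankel a r u = a (r + u) * complex_of_real (W r u)"

end

theory Submission
  imports Defs
begin

text \<open>
  Put \<open>n = r + u\<close>. Along the antidiagonal \<open>n\<close> the weight \<open>W (n - u) u\<close> is half of a binomial probability, at
  distance about \<open>u / 2\<close> from the centre of a distribution with about \<open>2 * n\<close> trials, times a square root that
  is bounded while \<open>u\<close> stays below \<open>n / 2\<close>. Hence it is comparable to \<open>1 / sqrt n\<close> for \<open>u \<le> sqrt n\<close>; and it is at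
  most \<open>1 / sqrt n\<close> for \<open>u \<ge> n / 2\<close>. A single unit coefficient at \<open>n\<close> therefore contributes a trace norm bounded
  below, and a \<^emph>\<open>window\<close> of about \<open>sqrt n / 2\<close> columns between \<open>sqrt n / 2\<close> and \<open>sqrt n\<close> already accounts for this.
  Coefficients at very sparse places \<open>node k\<close> have disjoint windows, so their contributions add up in \<open>\<ell>\<^sup>1\<close>
  fashion, while the norm of the sequence only adds up in \<open>\<ell>\<^sup>2\<close> fashion. With coefficient \<open>1 / (k + 1)\<close> at
  \<open>node k\<close> the sequence is square-summable, and the trace norms dominate a multiple of the harmonic series.

  Additivity is made precise without duality or a polar decomposition. Let \<open>T\<close> be the block, \<open>P = |T|\<close>,
  let \<open>e\<close> be the basis vector of a column \<open>u\<close> in the window of \<open>k\<close>, and let \<open>w\<close> be the norm of \<open>T e\<close>. The column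
  \<open>T e\<close> is almost orthogonal to all other columns, because the rows of its entries meet other antidiagonals
  only at columns where the weights are much smaller than \<open>w\<close>. So \<open>e\<close> is almost an eigenvector of
  \<open>P\<^sup>2 = T\<^sup>*T\<close> with eigenvalue \<open>w\<^sup>2\<close>. Since \<open>P\<^sup>2 - w\<^sup>2 = (P + w) (P - w)\<close> and \<open>P + w\<close> is bounded below by \<open>w\<close>, it is
  almost an eigenvector of \<open>P\<close> with eigenvalue \<open>w\<close> (lemma \<open>positive_op_approx_eigenvector\<close>). Summing the
  resulting lower bounds of \<open>\<langle>P e, e\<rangle>\<close> over all windows bounds the trace from below (lemma
  \<open>trace_norm_block_ge\<close>).

  The trace norm is defined through a choice of \<open>|T|\<close>, so the existence of \<open>|T|\<close> has to be established.
  For finite blocks this is the square root of a positive matrix (lemma \<open>positive_matrix_sqrt\<close>), and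
  finite blocks suffice: if the sequence is cut off after finitely many nodes, then an operator with the
  prescribed entries is forced by boundedness to be a finite block (lemma \<open>bounded_op_eq_block_op\<close>).
\<close>

section \<open>The sequence space\<close>

lemma fin_supp_ell2: "finite S \<Longrightarrow> (\<And>n. n \<notin> S \<Longrightarrow> x n = 0) \<Longrightarrow> x \<in> ell2"
  unfolding ell2_def by (auto intro!: summable_finite)

lemma basis_vec_ell2 [simp]: "basis_vec n \<in> ell2"
  by (rule fin_supp_ell2[of "{n}"]) (auto simp: basis_vec_def)

lemma ell2_scale: "x \<in> ell2 \<Longrightarrow> (\<lambda>n. c * x n) \<in> ell2"
  unfolding ell2_def by (auto simp: norm_mult power_mult_distrib intro: summable_mult)

lemma ell2_add:
  assumes "x \<in> ell2" "y \<in> ell2"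
  shows "(\<lambda>n. x n + y n) \<in> ell2"
proof -
  have "(cmod (x n + y n))\<^sup>2 \<le> 2 * (cmod (x n))\<^sup>2 + 2 * (cmod (y n))\<^sup>2" for n
  proof -
    have "(cmod (x n + y n))\<^sup>2 \<le> (cmod (x n) + cmod (y n))\<^sup>2"
      by (intro power_mono norm_triangle_ineq) auto
    also have "\<dots> \<le> 2 * (cmod (x n))\<^sup>2 + 2 * (cmod (y n))\<^sup>2"
      using sum_squares_bound[of "cmod (x n)" "cmod (y n)"] by (simp add: power2_sum)
    finally show ?thesis .
  qed
  moreover have "summable (\<lambda>n. 2 * (cmod (x n))\<^sup>2 + 2 * (cmod (y n))\<^sup>2)"
    using assms unfolding ell2_def by (auto intro!: summable_add summable_mult)
  ultimately show ?thesis
    unfolding ell2_def by (auto intro: summable_comparison_test'[where N = 0])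
qed

lemma ell2_inner_summable:
  assumes "x \<in> ell2" "y \<in> ell2"
  shows "summable (\<lambda>n. x n * cnj (y n))"
proof (rule summable_comparison_test)
  show "\<exists>N. \<forall>n\<ge>N. norm (x n * cnj (y n)) \<le> (cmod (x n))\<^sup>2 + (cmod (y n))\<^sup>2"
  proof (intro exI allI impI)
    fix n
    have "2 * (cmod (x n) * cmod (y n)) \<le> (cmod (x n))\<^sup>2 + (cmod (y n))\<^sup>2"
      using sum_squares_bound[of "cmod (x n)" "cmod (y n)"] by simp
    moreover have "0 \<le> cmod (x n) * cmod (y n)" by simp
    ultimately show "norm (x n * cnj (y n)) \<le> (cmod (x n))\<^sup>2 + (cmod (y n))\<^sup>2"
      unfolding norm_mult complex_mod_cnj by linarith
  qed
  show "summable (\<lambda>n. (cmod (x n))\<^sup>2 + (cmod (y n))\<^sup>2)"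
    using assms unfolding ell2_def by (auto intro: summable_add)
qed

lemma ell2_inner_add_scale_left:
  assumes "x \<in> ell2" "y \<in> ell2" "z \<in> ell2"
  shows "ell2_inner (\<lambda>n. x n + c * y n) z = ell2_inner x z + c * ell2_inner y z"
proof -
  have s: "summable (\<lambda>n. x n * cnj (z n))" "summable (\<lambda>n. y n * cnj (z n))"
    using assms ell2_inner_summable by blast+
  have "ell2_inner (\<lambda>n. x n + c * y n) z = (\<Sum>n. x n * cnj (z n) + c * (y n * cnj (z n)))"
    unfolding ell2_inner_def by (simp add: algebra_simps)
  also have "\<dots> = ell2_inner x z + c * ell2_inner y z"
    unfolding ell2_inner_def using s by (simp add: suminf_add[symmetric] suminf_mult summable_mult)
  finally show ?thesis .
qed

lemma ell2_inner_finite: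
  assumes "finite S" "\<And>n. n \<notin> S \<Longrightarrow> x n = 0 \<or> y n = 0"
  shows "ell2_inner x y = (\<Sum>n\<in>S. x n * cnj (y n))"
  unfolding ell2_inner_def using assms by (intro suminf_finite) auto

lemma ell2_inner_basis_vec [simp]: "ell2_inner x (basis_vec r) = x r"
  by (subst ell2_inner_finite[of "{r}"]) (auto simp: basis_vec_def)

lemma ell2_norm_finite:
  assumes "finite S" "\<And>n. n \<notin> S \<Longrightarrow> x n = 0"
  shows "ell2_norm x = L2_set (\<lambda>i. cmod (x i)) S"
  unfolding ell2_norm_def L2_set_def using assms by (subst suminf_finite[of S]) auto

lemma ell2_inner_self: "x \<in> ell2 \<Longrightarrow> ell2_inner x x = complex_of_real ((ell2_norm x)\<^sup>2)"
proof -
  assume "x \<in> ell2"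
  then have s: "summable (\<lambda>n. (cmod (x n))\<^sup>2)" by (simp add: ell2_def)
  have "ell2_inner x x = (\<Sum>n. complex_of_real ((cmod (x n))\<^sup>2))"
    by (simp only: ell2_inner_def complex_norm_square)
  also have "\<dots> = complex_of_real (\<Sum>n. (cmod (x n))\<^sup>2)"
    by (rule suminf_of_real[OF s, symmetric])
  also have "(\<Sum>n. (cmod (x n))\<^sup>2) = (ell2_norm x)\<^sup>2"
    using s by (simp add: ell2_norm_def suminf_nonneg)
  finally show ?thesis .
qed

lemma L2_set_le_ell2_norm:
  assumes "finite S" "x \<in> ell2"
  shows "L2_set (\<lambda>i. cmod (x i)) S \<le> ell2_norm x"
  unfolding L2_set_def ell2_norm_def using assms
  by (intro real_sqrt_le_mono sum_le_suminf) (auto simp: ell2_def)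

lemma ell2_coord_le: "x \<in> ell2 \<Longrightarrow> cmod (x n) \<le> ell2_norm x"
  using L2_set_le_ell2_norm[of "{n}" x] by simp

lemma ell2_norm_nonneg: "x \<in> ell2 \<Longrightarrow> 0 \<le> ell2_norm x"
  using order_trans[OF norm_ge_zero ell2_coord_le] .

section \<open>Square roots of positive matrices\<close>

text \<open>
  Matrices over a finite index set \<open>S\<close> are plain functions of two indices whose values outside \<open>S\<close> are
  irrelevant; \<open>S\<close> is passed explicitly, since the size of the blocks varies inside the argument.
\<close>

definition matvec :: "'i set \<Rightarrow> ('i \<Rightarrow> 'i \<Rightarrow> complex) \<Rightarrow> ('i \<Rightarrow> complex) \<Rightarrow> 'i \<Rightarrow> complex" where
  "matvec S M x i = (\<Sum>j\<in>S. M i j * x j)"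

definition matmul :: "'i set \<Rightarrow> ('i \<Rightarrow> 'i \<Rightarrow> complex) \<Rightarrow> ('i \<Rightarrow> 'i \<Rightarrow> complex) \<Rightarrow> 'i \<Rightarrow> 'i \<Rightarrow> complex" where
  "matmul S A B i j = (\<Sum>s\<in>S. A i s * B s j)"

abbreviation vnorm :: "'i set \<Rightarrow> ('i \<Rightarrow> complex) \<Rightarrow> real" where
  "vnorm S x \<equiv> L2_set (\<lambda>i. cmod (x i)) S"

definition opbound :: "'i set \<Rightarrow> ('i \<Rightarrow> 'i \<Rightarrow> complex) \<Rightarrow> real \<Rightarrow> bool" where
  "opbound S M c \<longleftrightarrow> (\<forall>x. vnorm S (matvec S M x) \<le> c * vnorm S x)"

lemma matvec_matmul: "matvec S (matmul S A B) x = matvec S A (matvec S B x)"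
  unfolding matvec_def matmul_def
  by (rule ext, simp add: sum_distrib_left sum_distrib_right mult.assoc, rule sum.swap)

lemma vnorm_triangle: "vnorm S (\<lambda>i. x i + y i) \<le> vnorm S x + vnorm S y"
proof -
  have "vnorm S (\<lambda>i. x i + y i) \<le> L2_set (\<lambda>i. cmod (x i) + cmod (y i)) S"
    by (intro L2_set_mono norm_triangle_ineq) auto
  also have "\<dots> \<le> vnorm S x + vnorm S y" by (rule L2_set_triangle_ineq)
  finally show ?thesis .
qed

lemma opbound_add:
  assumes "opbound S A c" "opbound S B d"
  shows "opbound S (\<lambda>i j. A i j + B i j) (c + d)"
  unfolding opbound_def
proof
  fix x
  have "matvec S (\<lambda>i j. A i j + B i j) x = (\<lambda>i. matvec S A x i + matvec S B x i)"
    by (auto simp: matvec_def algebra_simps sum.distrib)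
  then have "vnorm S (matvec S (\<lambda>i j. A i j + B i j) x) \<le> vnorm S (matvec S A x) + vnorm S (matvec S B x)"
    by (simp add: vnorm_triangle)
  also have "\<dots> \<le> (c + d) * vnorm S x"
    using assms unfolding opbound_def by (simp add: add_mono distrib_right)
  finally show "vnorm S (matvec S (\<lambda>i j. A i j + B i j) x) \<le> (c + d) * vnorm S x" .
qed

lemma opbound_scale:
  assumes "opbound S A c"
  shows "opbound S (\<lambda>i j. k * A i j) (cmod k * c)"
  unfolding opbound_def
proof
  fix x
  have "matvec S (\<lambda>i j. k * A i j) x = (\<lambda>i. k * matvec S A x i)"
    by (auto simp: matvec_def sum_distrib_left mult.assoc)
  then have "vnorm S (matvec S (\<lambda>i j. k * A i j) x) = cmod k * vnorm S (matvec S A x)"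
    by (simp add: norm_mult L2_set_right_distrib)
  also have "\<dots> \<le> cmod k * c * vnorm S x"
    using assms unfolding opbound_def by (simp add: mult.assoc mult_left_mono)
  finally show "vnorm S (matvec S (\<lambda>i j. k * A i j) x) \<le> cmod k * c * vnorm S x" .
qed

lemma opbound_matmul:
  assumes "opbound S A c" "opbound S B d" "0 \<le> c"
  shows "opbound S (matmul S A B) (c * d)"
  unfolding opbound_def matvec_matmul
proof
  fix x
  have "vnorm S (matvec S A (matvec S B x)) \<le> c * vnorm S (matvec S B x)"
    using assms unfolding opbound_def by blast
  also have "\<dots> \<le> c * (d * vnorm S x)"
    using assms unfolding opbound_def by (blast intro: mult_left_mono)
  finally show "vnorm S (matvec S A (matvec S B x)) \<le> c * d * vnorm S x" by (simp add: mult.assoc)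
qed

lemma opbound_entry:
  assumes "opbound S A c" "finite S" "i \<in> S" "j \<in> S"
  shows "cmod (A i j) \<le> c"
proof -
  define e where "e = (\<lambda>k. if k = j then 1 else 0 :: complex)"
  have "A i j = matvec S A e i"
    using assms by (simp add: matvec_def e_def if_distrib cong: if_cong)
  then have "cmod (A i j) \<le> vnorm S (matvec S A e)"
    using member_le_L2_set[OF assms(2,3), of "\<lambda>i. cmod (matvec S A e i)"] by simp
  also have "\<dots> \<le> c * vnorm S e" using assms unfolding opbound_def by blast
  also have "vnorm S e = 1"
  proof -
    have "(\<Sum>i\<in>S. (cmod (e i))\<^sup>2) = (\<Sum>i\<in>S. if i = j then 1 else 0)"
      by (intro sum.cong) (auto simp: e_def)
    then show ?thesis using assms by (simp add: L2_set_def)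
  qed
  finally show ?thesis by simp
qed

lemma opbound_entry_sum:
  assumes "finite S" shows "opbound S A (\<Sum>i\<in>S. \<Sum>j\<in>S. cmod (A i j))"
  unfolding opbound_def
proof
  fix x
  have "vnorm S (matvec S A x) \<le> (\<Sum>i\<in>S. cmod (matvec S A x i))"
    by (rule L2_set_le_sum) auto
  also have "\<dots> \<le> (\<Sum>i\<in>S. \<Sum>j\<in>S. cmod (A i j) * vnorm S x)"
  proof (rule sum_mono)
    fix i assume "i \<in> S"
    have "cmod (matvec S A x i) \<le> (\<Sum>j\<in>S. cmod (A i j) * cmod (x j))"
      unfolding matvec_def by (rule order_trans[OF norm_sum]) (simp add: norm_mult)
    also have "\<dots> \<le> (\<Sum>j\<in>S. cmod (A i j) * vnorm S x)"
      using assms by (intro sum_mono mult_left_mono member_le_L2_set[where f = "\<lambda>i. cmod (x i)"]) auto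
    finally show "cmod (matvec S A x i) \<le> (\<Sum>j\<in>S. cmod (A i j) * vnorm S x)" .
  qed
  finally show "vnorm S (matvec S A x) \<le> (\<Sum>i\<in>S. \<Sum>j\<in>S. cmod (A i j)) * vnorm S x"
    by (simp add: sum_distrib_right)
qed

text \<open>
  The square root of \<open>1 - B\<close> is found as \<open>1 - Y\<close>, where \<open>(1 - Y)\<^sup>2 = 1 - B\<close> amounts to the fixed point
  equation \<open>Y = (B + Y\<^sup>2) / 2\<close>. The iteration started at zero is compared with the same iteration for the
  scalar \<open>B = 1\<close>: its increments dominate those of the matrix iteration in operator norm.
\<close>

primrec sqrt_iter :: "'i set \<Rightarrow> ('i \<Rightarrow> 'i \<Rightarrow> complex) \<Rightarrow> nat \<Rightarrow> 'i \<Rightarrow> 'i \<Rightarrow> complex" where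
  "sqrt_iter S B 0 = (\<lambda>i j. 0)"
| "sqrt_iter S B (Suc n) = (\<lambda>i j. 1/2 * (B i j + matmul S (sqrt_iter S B n) (sqrt_iter S B n) i j))"

primrec sqrt_major :: "nat \<Rightarrow> real" where
  "sqrt_major 0 = 0"
| "sqrt_major (Suc n) = (1 + (sqrt_major n)\<^sup>2) / 2"

lemma sqrt_major_bounds: "0 \<le> sqrt_major n \<and> sqrt_major n \<le> 1"
proof (induction n)
  case (Suc n)
  then have "(sqrt_major n)\<^sup>2 \<le> 1" by (simp add: power_le_one)
  then show ?case by simp
qed simp

lemma opbound_sqrt_iter:
  assumes "opbound S B 1"
  shows "opbound S (sqrt_iter S B n) (sqrt_major n)"
proof (induction n)
  case 0
  have "opbound S (\<lambda>i j. 0 * B i j) 0" using opbound_scale[OF assms, of 0] by simp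
  then show ?case by simp
next
  case (Suc n)
  have "opbound S (\<lambda>i j. 1/2 * (B i j + matmul S (sqrt_iter S B n) (sqrt_iter S B n) i j))
     (cmod (1/2) * (1 + sqrt_major n * sqrt_major n))"
    using sqrt_major_bounds by (intro opbound_scale opbound_add opbound_matmul assms Suc) auto
  then show ?case by (simp add: power2_eq_square norm_divide)
qed

text \<open>
  Since \<open>Y\<^sup>2 - Z\<^sup>2 = Y (Y - Z) + (Y - Z) Z\<close> holds for noncommuting matrices too, the norm of the next
  increment is at most \<open>(y + z) (y - z) / 2\<close>, which is exactly the next increment of the scalar iteration.
\<close>

lemma opbound_sqrt_iter_diff:
  assumes "opbound S B 1"
  shows "opbound S (\<lambda>i j. sqrt_iter S B (Suc n) i j - sqrt_iter S B n i j)
    (sqrt_major (Suc n) - sqrt_major n)"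
proof (induction n)
  case 0
  show ?case using opbound_sqrt_iter[OF assms, of "Suc 0"] by simp
next
  case (Suc n)
  define Y Z where "Y = sqrt_iter S B (Suc n)" and "Z = sqrt_iter S B n"
  define y z where "y = sqrt_major (Suc n)" and "z = sqrt_major n"
  define D where "D = (\<lambda>i j. Y i j - Z i j)"
  have bnd: "opbound S Y y" "opbound S Z z" "opbound S D (y - z)" "0 \<le> y" 
    using opbound_sqrt_iter[OF assms] Suc sqrt_major_bounds
    unfolding Y_def Z_def D_def y_def z_def by blast+
  \<comment> \<open>The scalar step moves \<open>z\<close> by half of \<open>(1 - z)\<^sup>2\<close>.\<close>
  have "0 \<le> y - z"
  proof -
    have "0 \<le> (1 - z)\<^sup>2" by simp
    also have "\<dots> = 2 * (y - z)" by (simp add: y_def z_def power2_eq_square field_simps)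
    finally show ?thesis by simp
  qed
  then have "opbound S (\<lambda>i j. 1/2 * (matmul S Y D i j + matmul S D Z i j))
     (cmod (1/2) * (y * (y - z) + (y - z) * z))"
    using bnd by (intro opbound_scale opbound_add opbound_matmul)
  moreover have "(\<lambda>i j. 1/2 * (matmul S Y D i j + matmul S D Z i j)) =
     (\<lambda>i j. sqrt_iter S B (Suc (Suc n)) i j - sqrt_iter S B (Suc n) i j)"
  proof (intro ext)
    fix i j
    have "matmul S Y D i j + matmul S D Z i j = matmul S Y Y i j - matmul S Z Z i j"
      unfolding matmul_def D_def sum.distrib[symmetric] sum_subtractf[symmetric]
      by (intro sum.cong refl) (simp add: algebra_simps)
    moreover have "sqrt_iter S B (Suc (Suc n)) i j = 1/2 * (B i j + matmul S Y Y i j)"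
      by (simp only: sqrt_iter.simps(2)[of S B "Suc n"] Y_def)
    moreover have "sqrt_iter S B (Suc n) i j = 1/2 * (B i j + matmul S Z Z i j)"
      by (simp only: sqrt_iter.simps(2)[of S B "n"] Z_def)
    ultimately show "1/2 * (matmul S Y D i j + matmul S D Z i j)
       = sqrt_iter S B (Suc (Suc n)) i j - sqrt_iter S B (Suc n) i j"
      by (simp add: algebra_simps)
  qed
  moreover have "cmod (1/2) * (y * (y - z) + (y - z) * z) = sqrt_major (Suc (Suc n)) - sqrt_major (Suc n)"
  proof -
    have "sqrt_major (Suc (Suc n)) = (1 + y\<^sup>2) / 2" "sqrt_major (Suc n) = (1 + z\<^sup>2) / 2"
      by (simp_all add: y_def z_def)
    then show ?thesis
      by (simp only: norm_divide) (simp add: power2_eq_square field_simps del: sqrt_major.simps)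
  qed
  ultimately show ?case by (simp only:)
qed

lemma sqrt_iter_hermitian:
  assumes "\<And>i j. i \<in> S \<Longrightarrow> j \<in> S \<Longrightarrow> B j i = cnj (B i j)" "i \<in> S" "j \<in> S"
  shows "sqrt_iter S B n j i = cnj (sqrt_iter S B n i j)"
  using assms(2,3)
proof (induction n arbitrary: i j)
  case (Suc n)
  have "matmul S (sqrt_iter S B n) (sqrt_iter S B n) j i
      = cnj (matmul S (sqrt_iter S B n) (sqrt_iter S B n) i j)"
    unfolding matmul_def cnj_sum complex_cnj_mult
  proof (intro sum.cong refl)
    fix s assume "s \<in> S"
    then show "sqrt_iter S B n j s * sqrt_iter S B n s i
        = cnj (sqrt_iter S B n i s) * cnj (sqrt_iter S B n s j)"
      by (simp add: Suc.IH[of s j] Suc.IH[of i s] Suc.prems)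
  qed
  moreover have "B j i = cnj (B i j)" using assms(1) Suc.prems by blast
  ultimately show ?case by simp
qed simp

text \<open>
  The increments are summable entrywise because the scalar increments telescope below 1.
\<close>

lemma convergent_sqrt_iter:
  assumes "opbound S B 1" "finite S" "i \<in> S" "j \<in> S"
  shows "convergent (\<lambda>n. sqrt_iter S B n i j)"
proof -
  have "summable (\<lambda>n. sqrt_major (Suc n) - sqrt_major n)"
  proof (rule bounded_imp_summable[of _ 1])
    show "0 \<le> sqrt_major (Suc n) - sqrt_major n" for n
      by (rule order_trans[OF norm_ge_zero opbound_entry[OF opbound_sqrt_iter_diff[OF assms(1)] assms(2-4)]])
    show "(\<Sum>k\<le>n. sqrt_major (Suc k) - sqrt_major k) \<le> 1" for n
      using sum_lessThan_telescope[of sqrt_major "Suc n"] sqrt_major_bounds[of "Suc n"]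
      by (simp add: lessThan_Suc_atMost del: sqrt_major.simps(2))
  qed
  moreover have "norm (sqrt_iter S B (Suc n) i j - sqrt_iter S B n i j) \<le> sqrt_major (Suc n) - sqrt_major n" for n
    by (rule opbound_entry[OF opbound_sqrt_iter_diff[OF assms(1)] assms(2-4)])
  ultimately have "summable (\<lambda>n. sqrt_iter S B (Suc n) i j - sqrt_iter S B n i j)"
    by (rule summable_comparison_test'[where N = 0])
  then have "convergent (\<lambda>n. \<Sum>k<n. sqrt_iter S B (Suc k) i j - sqrt_iter S B k i j)"
    by (simp add: summable_iff_convergent)
  then show ?thesis
    unfolding sum_lessThan_telescope[of "\<lambda>k. sqrt_iter S B k i j"] by simp
qed

text \<open>
  The limit \<open>Y\<close> of the iteration is Hermitian and has norm at most 1, which makes \<open>1 - Y\<close> positive.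
\<close>

lemma positive_matrix_sqrt:
  assumes S: "finite S" and B1: "opbound S B 1"
    and herm: "\<And>i j. i \<in> S \<Longrightarrow> j \<in> S \<Longrightarrow> B j i = cnj (B i j)"
  obtains P where
    "\<And>i j. i \<in> S \<Longrightarrow> j \<in> S \<Longrightarrow> P j i = cnj (P i j)"
    "\<And>x. 0 \<le> Re (\<Sum>i\<in>S. matvec S P x i * cnj (x i))"
    "\<And>i j. i \<in> S \<Longrightarrow> j \<in> S \<Longrightarrow> matmul S P P i j = (if i = j then 1 else 0) - B i j"
proof -
  define Y where "Y = (\<lambda>i j. lim (\<lambda>n. sqrt_iter S B n i j))"
  have lim: "(\<lambda>n. sqrt_iter S B n i j) \<longlonglongrightarrow> Y i j" if "i \<in> S" "j \<in> S" for i j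
    using convergent_sqrt_iter[OF B1 S that] by (simp add: Y_def convergent_LIMSEQ_iff)
  have Yherm: "Y j i = cnj (Y i j)" if "i \<in> S" "j \<in> S" for i j
  proof (rule LIMSEQ_unique[OF lim])
    show "(\<lambda>n. sqrt_iter S B n j i) \<longlonglongrightarrow> cnj (Y i j)"
      using tendsto_cnj[OF lim[OF that]] sqrt_iter_hermitian[OF herm that] by simp
  qed (use that in auto)
  have Yeq: "Y i j = 1/2 * (B i j + matmul S Y Y i j)" if "i \<in> S" "j \<in> S" for i j
  proof (rule LIMSEQ_unique)
    show "(\<lambda>n. sqrt_iter S B (Suc n) i j) \<longlonglongrightarrow> Y i j"
      using lim[OF that] by (rule LIMSEQ_Suc)
    show "(\<lambda>n. sqrt_iter S B (Suc n) i j) \<longlonglongrightarrow> 1/2 * (B i j + matmul S Y Y i j)"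
      unfolding sqrt_iter.simps matmul_def
      by (intro tendsto_intros tendsto_sum lim that)
  qed
  have Ybnd: "vnorm S (matvec S Y x) \<le> vnorm S x" for x
  proof (rule LIMSEQ_le_const2)
    show "(\<lambda>n. vnorm S (matvec S (sqrt_iter S B n) x)) \<longlonglongrightarrow> vnorm S (matvec S Y x)"
      unfolding L2_set_def matvec_def by (intro tendsto_intros tendsto_sum lim)
    have "vnorm S (matvec S (sqrt_iter S B n) x) \<le> vnorm S x" for n
    proof -
      have "vnorm S (matvec S (sqrt_iter S B n) x) \<le> sqrt_major n * vnorm S x"
        using opbound_sqrt_iter[OF B1] unfolding opbound_def by blast
      also have "\<dots> \<le> 1 * vnorm S x"
        using sqrt_major_bounds by (intro mult_right_mono) auto
      finally show ?thesis by simp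
    qed
    then show "\<exists>N. \<forall>n\<ge>N. vnorm S (matvec S (sqrt_iter S B n) x) \<le> vnorm S x" by blast
  qed
  define P where "P = (\<lambda>i j. (if i = j then 1 else 0) - Y i j)"
  show ?thesis
  proof
    show "P j i = cnj (P i j)" if "i \<in> S" "j \<in> S" for i j
      using Yherm[OF that] by (auto simp: P_def)
    show "matmul S P P i j = (if i = j then 1 else 0) - B i j" if "i \<in> S" "j \<in> S" for i j
    proof -
      have "matmul S P P i j = (\<Sum>s\<in>S. (if s = i then (if i = j then 1 else 0) - Y i j else 0)
            - (if s = j then Y i j else 0) + Y i s * Y s j)"
        unfolding matmul_def P_def by (intro sum.cong) (auto simp: algebra_simps)
      also have "\<dots> = (if i = j then 1 else 0) - 2 * Y i j + matmul S Y Y i j"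
        using that S by (simp add: sum.distrib sum_subtractf matmul_def)
      also have "\<dots> = (if i = j then 1 else 0) - B i j"
        using Yeq[OF that] by (simp add: field_simps)
      finally show ?thesis .
    qed
    show "0 \<le> Re (\<Sum>i\<in>S. matvec S P x i * cnj (x i))" for x
    proof -
      have "cmod (\<Sum>i\<in>S. matvec S Y x i * cnj (x i)) \<le> (\<Sum>i\<in>S. \<bar>cmod (matvec S Y x i)\<bar> * \<bar>cmod (x i)\<bar>)"
        by (rule order_trans[OF norm_sum]) (simp add: norm_mult)
      also have "\<dots> \<le> vnorm S (matvec S Y x) * vnorm S x" by (rule L2_set_mult_ineq)
      also have "\<dots> \<le> vnorm S x * vnorm S x" using Ybnd by (intro mult_right_mono) auto
      also have "\<dots> = (\<Sum>i\<in>S. (cmod (x i))\<^sup>2)"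
        by (simp add: L2_set_def sum_nonneg)
      finally have "Re (\<Sum>i\<in>S. matvec S Y x i * cnj (x i)) \<le> (\<Sum>i\<in>S. (cmod (x i))\<^sup>2)"
        by (rule order_trans[OF complex_Re_le_cmod])
      moreover have "matvec S P x i = x i - matvec S Y x i" if "i \<in> S" for i
        using that S by (simp add: matvec_def P_def left_diff_distrib sum_subtractf if_distrib[of "\<lambda>c. c * _"] cong: if_cong)
      then have "(\<Sum>i\<in>S. matvec S P x i * cnj (x i)) = (\<Sum>i\<in>S. x i * cnj (x i)) - (\<Sum>i\<in>S. matvec S Y x i * cnj (x i))"
        by (simp add: left_diff_distrib sum_subtractf)
      moreover have "(\<Sum>i\<in>S. x i * cnj (x i)) = complex_of_real (\<Sum>i\<in>S. (cmod (x i))\<^sup>2)"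
        by (simp only: complex_norm_square of_real_sum)
      ultimately show ?thesis by simp
    qed
  qed
qed

definition adjoint_matrix :: "('i \<Rightarrow> 'i \<Rightarrow> complex) \<Rightarrow> 'i \<Rightarrow> 'i \<Rightarrow> complex" where
  "adjoint_matrix M i j = cnj (M j i)"

lemma matvec_adjoint:
  "(\<Sum>i\<in>S. matvec S (adjoint_matrix M) x i * cnj (y i)) = (\<Sum>r\<in>S. x r * cnj (matvec S M y r))"
  unfolding matvec_def adjoint_matrix_def cnj_sum sum_distrib_left sum_distrib_right
  by (subst sum.swap) (simp add: mult_ac)

text \<open>
  With \<open>t = T x\<close> and \<open>y = T\<^sup>* t\<close> one has \<open>\<parallel>x - y\<parallel>\<^sup>2 = \<parallel>x\<parallel>\<^sup>2 - 2 \<parallel>t\<parallel>\<^sup>2 + \<parallel>y\<parallel>\<^sup>2\<close>, and \<open>\<parallel>y\<parallel> \<le> \<parallel>t\<parallel>\<close> because \<open>T\<^sup>*\<close> is a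
  contraction.
\<close>

lemma opbound_one_minus_gram:
  assumes S: "finite S" and T: "opbound S T 1" "opbound S (adjoint_matrix T) 1"
  shows "opbound S (\<lambda>i j. (if i = j then 1 else 0) - matmul S (adjoint_matrix T) T i j) 1"
  unfolding opbound_def
proof
  fix x
  define t y where "t = matvec S T x" and "y = matvec S (adjoint_matrix T) t"
  have mv: "matvec S (\<lambda>i j. (if i = j then 1 else 0) - matmul S (adjoint_matrix T) T i j) x i = x i - y i"
    if "i \<in> S" for i
  proof -
    have "matvec S (\<lambda>i j. (if i = j then 1 else 0) - matmul S (adjoint_matrix T) T i j) x i
      = (\<Sum>j\<in>S. if i = j then x j else 0) - matvec S (matmul S (adjoint_matrix T) T) x i"
      unfolding matvec_def sum_subtractf[symmetric] by (intro sum.cong) (auto simp: algebra_simps)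
    then show ?thesis using that S by (simp add: y_def t_def matvec_matmul)
  qed
  have "(\<Sum>i\<in>S. y i * cnj (x i)) = (\<Sum>r\<in>S. t r * cnj (t r))"
    unfolding y_def t_def by (rule matvec_adjoint)
  then have re: "Re (\<Sum>i\<in>S. y i * cnj (x i)) = (vnorm S t)\<^sup>2"
    by (simp only: complex_norm_square[symmetric] of_real_sum[symmetric] Re_complex_of_real)
      (simp add: L2_set_def sum_nonneg)
  have "(vnorm S (\<lambda>i. x i - y i))\<^sup>2 = (\<Sum>i\<in>S. (cmod (x i))\<^sup>2 - 2 * Re (y i * cnj (x i)) + (cmod (y i))\<^sup>2)"
  proof -
    have "(cmod (x i - y i))\<^sup>2 = (cmod (x i))\<^sup>2 - 2 * Re (y i * cnj (x i)) + (cmod (y i))\<^sup>2" for i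
      by (simp add: cmod_power2 power2_diff algebra_simps)
    then have "(\<Sum>i\<in>S. (cmod (x i))\<^sup>2 - 2 * Re (y i * cnj (x i)) + (cmod (y i))\<^sup>2)
        = (\<Sum>i\<in>S. (cmod (x i - y i))\<^sup>2)" by simp
    then show ?thesis by (simp only: L2_set_def) (simp add: sum_nonneg)
  qed
  also have "\<dots> = (vnorm S x)\<^sup>2 - 2 * (vnorm S t)\<^sup>2 + (vnorm S y)\<^sup>2"
    unfolding re[symmetric]
    by (simp add: L2_set_def sum_nonneg sum.distrib sum_subtractf sum_distrib_left)
  also have "(vnorm S y)\<^sup>2 \<le> (vnorm S t)\<^sup>2"
    using T(2) unfolding opbound_def y_def by (intro power_mono) auto
  then have "(vnorm S x)\<^sup>2 - 2 * (vnorm S t)\<^sup>2 + (vnorm S y)\<^sup>2 \<le> (vnorm S x)\<^sup>2"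
    using zero_le_power2[of "vnorm S t"] by linarith
  finally have "vnorm S (\<lambda>i. x i - y i) \<le> vnorm S x"
    by (rule power2_le_imp_le) simp
  moreover have "vnorm S (matvec S (\<lambda>i j. (if i = j then 1 else 0) - matmul S (adjoint_matrix T) T i j) x)
      = vnorm S (\<lambda>i. x i - y i)"
    using mv by (intro L2_set_cong) auto
  ultimately show "vnorm S (matvec S (\<lambda>i j. (if i = j then 1 else 0) - matmul S (adjoint_matrix T) T i j) x)
      \<le> 1 * vnorm S x" by simp
qed

lemma opbound_mono: "opbound S A c \<Longrightarrow> c \<le> d \<Longrightarrow> opbound S A d"
  unfolding opbound_def by (meson L2_set_nonneg mult_right_mono order_trans)

text \<open>
  Dividing \<open>M\<close> by a bound \<open>c\<close> for the norms of \<open>M\<close> and \<open>M\<^sup>*\<close> reduces this to a contraction.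
\<close>

lemma gram_matrix_sqrt:
  assumes S: "finite S"
  obtains P where
    "\<And>i j. i \<in> S \<Longrightarrow> j \<in> S \<Longrightarrow> P j i = cnj (P i j)"
    "\<And>x. 0 \<le> Re (\<Sum>i\<in>S. matvec S P x i * cnj (x i))"
    "\<And>i j. i \<in> S \<Longrightarrow> j \<in> S \<Longrightarrow> matmul S P P i j = matmul S (adjoint_matrix M) M i j"
proof -
  define c where "c = 1 + (\<Sum>i\<in>S. \<Sum>j\<in>S. cmod (M i j))"
  define T where "T = (\<lambda>i j. complex_of_real (1/c) * M i j)"
  have c: "c \<ge> 1" by (simp add: c_def sum_nonneg)
  have bnd: "opbound S (\<lambda>i j. complex_of_real (1/c) * N i j) 1"
    if "(\<Sum>i\<in>S. \<Sum>j\<in>S. cmod (N i j)) \<le> c" for N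
    by (rule opbound_mono[OF opbound_scale[OF opbound_entry_sum[OF S]]])
      (use c that in \<open>simp add: norm_divide\<close>)
  have T1: "opbound S T 1" unfolding T_def by (rule bnd) (simp add: c_def)
  have "adjoint_matrix T = (\<lambda>i j. complex_of_real (1/c) * adjoint_matrix M i j)" by (simp add: T_def adjoint_matrix_def fun_eq_iff)
  moreover have "(\<Sum>i\<in>S. \<Sum>j\<in>S. cmod (adjoint_matrix M i j)) \<le> c"
    unfolding c_def adjoint_matrix_def by (subst sum.swap) simp
  ultimately have T2: "opbound S (adjoint_matrix T) 1" using bnd by simp
  have herm: "(if j = i then 1 else 0) - matmul S (adjoint_matrix T) T j i
      = cnj ((if i = j then 1 else 0) - matmul S (adjoint_matrix T) T i j)" for i j
    by (auto simp: matmul_def adjoint_matrix_def mult.commute)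
  obtain Q where Q:
    "\<And>i j. i \<in> S \<Longrightarrow> j \<in> S \<Longrightarrow> Q j i = cnj (Q i j)"
    "\<And>x. 0 \<le> Re (\<Sum>i\<in>S. matvec S Q x i * cnj (x i))"
    "\<And>i j. i \<in> S \<Longrightarrow> j \<in> S \<Longrightarrow> matmul S Q Q i j
        = (if i = j then 1 else 0) - ((if i = j then 1 else 0) - matmul S (adjoint_matrix T) T i j)"
    using positive_matrix_sqrt[OF S opbound_one_minus_gram[OF S T1 T2] herm] by blast
  show ?thesis
  proof
    let ?P = "\<lambda>i j. complex_of_real c * Q i j"
    show "?P j i = cnj (?P i j)" if "i \<in> S" "j \<in> S" for i j
      using Q(1)[OF that] by simp
    show "0 \<le> Re (\<Sum>i\<in>S. matvec S ?P x i * cnj (x i))" for x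
    proof -
      have "(\<Sum>i\<in>S. matvec S ?P x i * cnj (x i)) = complex_of_real c * (\<Sum>i\<in>S. matvec S Q x i * cnj (x i))"
        by (simp add: matvec_def sum_distrib_left sum_distrib_right mult_ac)
      then show ?thesis using Q(2)[of x] c by simp
    qed
    show "matmul S ?P ?P i j = matmul S (adjoint_matrix M) M i j" if "i \<in> S" "j \<in> S" for i j
    proof -
      have "matmul S ?P ?P i j = (complex_of_real c)\<^sup>2 * matmul S Q Q i j"
        by (simp add: matmul_def sum_distrib_left power2_eq_square mult_ac)
      also have "\<dots> = (complex_of_real c)\<^sup>2 * matmul S (adjoint_matrix T) T i j" using Q(3)[OF that] by simp
      also have "\<dots> = (\<Sum>s\<in>S. (complex_of_real c)\<^sup>2 * (complex_of_real (1/c))\<^sup>2 * (adjoint_matrix M i s * M s j))"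
        by (simp add: matmul_def sum_distrib_left power2_eq_square mult_ac T_def adjoint_matrix_def)
      also have "(complex_of_real c)\<^sup>2 * (complex_of_real (1/c))\<^sup>2 = 1"
        using c by (simp add: power_divide)
      finally show ?thesis by (simp add: matmul_def)
    qed
  qed
qed

section \<open>Absolute values of finite blocks\<close>

lemma block_op_eq: "block_op M S S x = (\<lambda>r. if r \<in> S then matvec S M x r else 0)"
  by (simp add: block_op_def matvec_def fun_eq_iff)

lemma matvec_cong: "(\<And>i. i \<in> S \<Longrightarrow> x i = y i) \<Longrightarrow> matvec S M x = matvec S M y"
  by (simp add: matvec_def fun_eq_iff)

lemma bounded_op_block_op:
  assumes S: "finite S"
  shows "bounded_op (block_op M S S)"
  unfolding bounded_op_def
proof (intro conjI ballI allI)
  show "block_op M S S x \<in> ell2" for x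
    by (rule fin_supp_ell2[OF S]) (simp add: block_op_def)
  show "block_op M S S (\<lambda>n. x n + y n) = (\<lambda>n. block_op M S S x n + block_op M S S y n)" for x y
    by (auto simp: block_op_def algebra_simps sum.distrib)
  show "block_op M S S (\<lambda>n. c * x n) = (\<lambda>n. c * block_op M S S x n)" for c x
    by (auto simp: block_op_def sum_distrib_left mult_ac)
  define s where "s = (\<Sum>i\<in>S. \<Sum>j\<in>S. cmod (M i j))"
  have s: "s \<ge> 0" by (simp add: s_def sum_nonneg)
  have "ell2_norm (block_op M S S x) \<le> s * ell2_norm x" if "x \<in> ell2" for x
  proof -
    have "ell2_norm (block_op M S S x) = vnorm S (block_op M S S x)"
      by (rule ell2_norm_finite[OF S]) (simp add: block_op_def)
    also have "\<dots> = vnorm S (matvec S M x)" by (rule L2_set_cong) (auto simp: block_op_eq)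
    also have "\<dots> \<le> s * vnorm S x"
      using opbound_entry_sum[OF S, of M] unfolding opbound_def s_def by blast
    also have "\<dots> \<le> s * ell2_norm x"
      by (intro mult_left_mono L2_set_le_ell2_norm S that s)
    finally show ?thesis .
  qed
  with s show "\<exists>C\<ge>0. \<forall>x\<in>ell2. ell2_norm (block_op M S S x) \<le> C * ell2_norm x" by blast
qed

text \<open>
  The value chosen by \<open>abs_op\<close> is meaningful as soon as some candidate exists; the zero extension of
  the square root of \<open>M\<^sup>* M\<close> is one.
\<close>

lemma is_abs_op_block_op:
  assumes S: "finite S"
  shows "is_abs_op (block_op M S S) (abs_op (block_op M S S))"
proof -
  obtain P where P:
    "\<And>i j. i \<in> S \<Longrightarrow> j \<in> S \<Longrightarrow> P j i = cnj (P i j)"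
    "\<And>x. 0 \<le> Re (\<Sum>i\<in>S. matvec S P x i * cnj (x i))"
    "\<And>i j. i \<in> S \<Longrightarrow> j \<in> S \<Longrightarrow> matmul S P P i j = matmul S (adjoint_matrix M) M i j"
    using gram_matrix_sqrt[OF S] by blast
  have inner: "ell2_inner (block_op P S S x) y = (\<Sum>i\<in>S. matvec S P x i * cnj (y i))" for x y
  proof -
    have "ell2_inner (block_op P S S x) y = (\<Sum>i\<in>S. block_op P S S x i * cnj (y i))"
      by (rule ell2_inner_finite[OF S]) (simp add: block_op_def)
    then show ?thesis by (simp add: block_op_eq)
  qed
  have "is_abs_op (block_op M S S) (block_op P S S)"
    unfolding is_abs_op_def positive_op_def
  proof (intro conjI ballI bounded_op_block_op S)
    fix x :: "nat \<Rightarrow> complex"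
    have "adjoint_matrix P i j = P i j" if "i \<in> S" "j \<in> S" for i j
      using P(1)[OF that(2,1)] by (simp add: adjoint_matrix_def)
    then have "matvec S P x i = matvec S (adjoint_matrix P) x i" if "i \<in> S" for i
      using that by (simp add: matvec_def)
    then have "(\<Sum>i\<in>S. matvec S P x i * cnj (x i)) = (\<Sum>i\<in>S. x i * cnj (matvec S P x i))"
      by (simp add: matvec_adjoint)
    also have "\<dots> = cnj (\<Sum>i\<in>S. matvec S P x i * cnj (x i))"
      by (simp add: mult.commute)
    finally have "(\<Sum>i\<in>S. matvec S P x i * cnj (x i)) \<in> \<real>"
      by (simp add: Reals_cnj_iff)
    then show "ell2_inner (block_op P S S x) x \<in> \<real>\<^sub>\<ge>\<^sub>0"
      unfolding inner using P(2)[of x] by (simp add: complex_nonneg_Reals_iff complex_is_Real_iff)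
  next
    fix x y :: "nat \<Rightarrow> complex"
    have "ell2_inner (block_op P S S (block_op P S S x)) y
        = (\<Sum>i\<in>S. matvec S P (matvec S P x) i * cnj (y i))"
      unfolding inner by (subst matvec_cong[where y = "matvec S P x"]) (auto simp: block_op_eq)
    also have "\<dots> = (\<Sum>i\<in>S. matvec S (matmul S (adjoint_matrix M) M) x i * cnj (y i))"
      using P(3) unfolding matvec_matmul[symmetric] by (intro sum.cong) (auto simp: matvec_def)
    also have "\<dots> = (\<Sum>r\<in>S. matvec S M x r * cnj (matvec S M y r))"
      unfolding matvec_matmul matvec_adjoint ..
    also have "\<dots> = ell2_inner (block_op M S S x) (block_op M S S y)"
      by (subst ell2_inner_finite[OF S]) (auto simp: block_op_eq)
    finally show "ell2_inner (block_op P S S (block_op P S S x)) y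
        = ell2_inner (block_op M S S x) (block_op M S S y)" .
  qed
  then show ?thesis unfolding abs_op_def by (rule someI[of "is_abs_op (block_op M S S)"])
qed

section \<open>Diagonal entries of an absolute value\<close>

text \<open>
  Let \<open>e\<close> be the basis vector, \<open>z = P e - w e\<close> and \<open>\<delta> = P\<^sup>2 e - w\<^sup>2 e\<close>. Then \<open>P z + w z = \<delta>\<close>, and positivity of \<open>P\<close> gives
  \<open>w \<parallel>z\<parallel>\<^sup>2 \<le> Re \<langle>\<delta>, z\<rangle> \<le> D \<parallel>z\<parallel>\<close> with \<open>D\<close> the \<open>\<ell>\<^sup>1\<close> norm of \<open>\<delta>\<close>. So \<open>\<parallel>z\<parallel> \<le> D / w\<close>, which bounds the distance of
  \<open>\<langle>P e, e\<rangle>\<close> from \<open>w\<close>.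
\<close>

lemma positive_op_approx_eigenvector:
  assumes P: "positive_op P" and S: "finite S" and w: "w > 0"
    and supp: "\<And>v. v \<notin> S \<Longrightarrow> P (P (basis_vec u)) v = complex_of_real (w\<^sup>2) * basis_vec u v"
  shows "w - (\<Sum>v\<in>S. cmod (P (P (basis_vec u)) v - complex_of_real (w\<^sup>2) * basis_vec u v)) / w
     \<le> Re (P (basis_vec u) u)"
proof -
  define e where "e = basis_vec u"
  define \<delta> where "\<delta> = (\<lambda>v. P (P e) v - complex_of_real (w\<^sup>2) * e v)"
  define D where "D = (\<Sum>v\<in>S. cmod (\<delta> v))"
  define z where "z = (\<lambda>n. P e n + (- complex_of_real w) * e n)"
  have b: "bounded_op P" using P by (simp add: positive_op_def)
  have e: "e \<in> ell2" "e u = 1" by (simp_all add: e_def) (simp add: basis_vec_def)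
  have Pe: "P x \<in> ell2" if "x \<in> ell2" for x using b that by (auto simp: bounded_op_def)
  have z: "z \<in> ell2" unfolding z_def by (intro ell2_add ell2_scale Pe e)
  have "P z = (\<lambda>n. P (P e) n + (- complex_of_real w) * P e n)"
  proof -
    have "P z = (\<lambda>n. P (P e) n + P (\<lambda>n. (- complex_of_real w) * e n) n)"
      unfolding z_def using b Pe[OF e(1)] ell2_scale[OF e(1), of "- complex_of_real w"]
      unfolding bounded_op_def by meson
    also have "P (\<lambda>n. (- complex_of_real w) * e n) = (\<lambda>n. (- complex_of_real w) * P e n)"
      using b e unfolding bounded_op_def by blast
    finally show ?thesis .
  qed
  then have d: "\<delta> = (\<lambda>n. P z n + complex_of_real w * z n)"
    by (auto simp: \<delta>_def z_def algebra_simps power2_eq_square)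
  have D0: "0 \<le> D" by (simp add: D_def sum_nonneg)
  have "w * (ell2_norm z)\<^sup>2 \<le> Re (ell2_inner \<delta> z)"
  proof -
    have "ell2_inner \<delta> z = ell2_inner (P z) z + complex_of_real w * ell2_inner z z"
      unfolding d by (intro ell2_inner_add_scale_left Pe z)
    moreover have "Re (ell2_inner (P z) z) \<ge> 0"
      using P z by (auto simp: positive_op_def complex_nonneg_Reals_iff)
    ultimately show ?thesis by (simp add: ell2_inner_self z)
  qed
  also have "ell2_inner \<delta> z = (\<Sum>v\<in>S. \<delta> v * cnj (z v))"
    using supp by (intro ell2_inner_finite S) (auto simp: \<delta>_def e_def)
  also have "Re \<dots> \<le> cmod (\<Sum>v\<in>S. \<delta> v * cnj (z v))" by (rule complex_Re_le_cmod)
  also have "\<dots> \<le> (\<Sum>v\<in>S. cmod (\<delta> v) * ell2_norm z)"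
    by (rule order_trans[OF norm_sum])
      (auto simp: norm_mult intro!: sum_mono mult_left_mono ell2_coord_le z)
  also have "\<dots> = D * ell2_norm z" by (simp add: D_def sum_distrib_right)
  finally have "w * ell2_norm z * ell2_norm z \<le> D * ell2_norm z"
    by (simp add: power2_eq_square mult.assoc)
  then have "w * ell2_norm z \<le> D"
    using ell2_norm_nonneg[OF z] D0 by (cases "ell2_norm z = 0") auto
  then have "ell2_norm z \<le> D / w" using w by (simp add: field_simps)
  moreover have "cmod (z u) \<le> ell2_norm z" by (rule ell2_coord_le[OF z])
  moreover have "Re (P e u) = w + Re (z u)" by (simp add: z_def e)
  moreover have "- cmod (z u) \<le> Re (z u)" using abs_Re_le_cmod[of "z u"] by linarith
  ultimately have "w - D / w \<le> Re (P e u)" by linarith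
  then show ?thesis by (simp add: D_def \<delta>_def e_def)
qed

text \<open>
  Here \<open>w\<close> is the norm of column \<open>u\<close>, so that \<open>\<delta>\<close> consists of the inner products of column \<open>u\<close> with the other
  columns. Every entry of column \<open>u\<close> is at most \<open>w\<close>, hence after division by \<open>w\<close> only the other entries of
  the rows that column \<open>u\<close> meets are left.
\<close>

lemma abs_op_diagonal_ge:
  fixes M :: "nat \<Rightarrow> nat \<Rightarrow> real"
  assumes S: "finite S" and M: "\<And>r v. M r v \<ge> 0" and u: "u \<in> S" and r0: "r0 \<in> S"
    and P: "is_abs_op (block_op (\<lambda>r v. complex_of_real (M r v)) S S) P"
  shows "M r0 u - (\<Sum>r | r \<in> S \<and> M r u \<noteq> 0. \<Sum>v\<in>S - {u}. M r v) \<le> Re (P (basis_vec u) u)"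
proof (cases "M r0 u = 0")
  case True
  have "Re (ell2_inner (P (basis_vec u)) (basis_vec u)) \<ge> 0"
    using P basis_vec_ell2 unfolding is_abs_op_def positive_op_def complex_nonneg_Reals_iff by blast
  moreover have "(\<Sum>r | r \<in> S \<and> M r u \<noteq> 0. \<Sum>v\<in>S - {u}. M r v) \<ge> 0" by (intro sum_nonneg M)
  ultimately show ?thesis using True by simp
next
  case False
  define T where "T = block_op (\<lambda>r v. complex_of_real (M r v)) S S"
  define w where "w = L2_set (\<lambda>r. M r u) S"
  have le_w: "M r u \<le> w" if "r \<in> S" for r
    unfolding w_def using member_le_L2_set[OF S that, of "\<lambda>r. M r u"] .
  have w: "w > 0" using le_w[OF r0] False M[of r0 u] by linarith
  have w2: "w\<^sup>2 = (\<Sum>r\<in>S. (M r u)\<^sup>2)" by (simp add: w_def L2_set_def sum_nonneg)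
  have T: "T (basis_vec v) = (\<lambda>r. if r \<in> S \<and> v \<in> S then complex_of_real (M r v) else 0)" for v
    using S by (auto simp: T_def block_op_def basis_vec_def if_distrib fun_eq_iff cong: if_cong)
  have PP: "P (P (basis_vec u)) v = (if v \<in> S then complex_of_real (\<Sum>r\<in>S. M r u * M r v) else 0)" for v
  proof -
    have "P (P (basis_vec u)) v = ell2_inner (P (P (basis_vec u))) (basis_vec v)" by simp
    also have "\<dots> = ell2_inner (T (basis_vec u)) (T (basis_vec v))"
      using P basis_vec_ell2 unfolding T_def is_abs_op_def by blast
    also have "\<dots> = (if v \<in> S then complex_of_real (\<Sum>r\<in>S. M r u * M r v) else 0)"
      using u by (subst ell2_inner_finite[OF S]) (auto simp: T)
    finally show ?thesis .
  qed
  have diag: "P (P (basis_vec u)) u = complex_of_real (w\<^sup>2)"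
    using u unfolding PP w2 by (simp only: power2_eq_square if_True)
  have "w - (\<Sum>v\<in>S. cmod (P (P (basis_vec u)) v - complex_of_real (w\<^sup>2) * basis_vec u v)) / w
     \<le> Re (P (basis_vec u) u)"
  proof (rule positive_op_approx_eigenvector[OF _ S w])
    show "positive_op P" using P by (simp add: is_abs_op_def)
    fix v assume "v \<notin> S"
    moreover from this u have "basis_vec u v = 0" by (auto simp: basis_vec_def)
    ultimately show "P (P (basis_vec u)) v = complex_of_real (w\<^sup>2) * basis_vec u v"
      by (simp add: PP)
  qed
  moreover have "(\<Sum>v\<in>S. cmod (P (P (basis_vec u)) v - complex_of_real (w\<^sup>2) * basis_vec u v))
      \<le> w * (\<Sum>r | r \<in> S \<and> M r u \<noteq> 0. \<Sum>v\<in>S - {u}. M r v)"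
  proof -
    have "(\<Sum>v\<in>S. cmod (P (P (basis_vec u)) v - complex_of_real (w\<^sup>2) * basis_vec u v))
        = (\<Sum>v\<in>S - {u}. \<Sum>r\<in>S. M r u * M r v)"
    proof (rule sum.mono_neutral_cong_right[OF S])
      show "\<forall>v\<in>S - (S - {u}). cmod (P (P (basis_vec u)) v - complex_of_real (w\<^sup>2) * basis_vec u v) = 0"
        using diag by (auto simp: basis_vec_def)
      show "cmod (P (P (basis_vec u)) v - complex_of_real (w\<^sup>2) * basis_vec u v) = (\<Sum>r\<in>S. M r u * M r v)"
        if "v \<in> S - {u}" for v
      proof -
        have "basis_vec u v = 0" using that by (auto simp: basis_vec_def)
        then show ?thesis using that M by (simp add: PP sum_nonneg del: of_real_sum)
      qed
    qed auto
    also have "\<dots> = (\<Sum>r\<in>S. M r u * (\<Sum>v\<in>S - {u}. M r v))"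
      by (subst sum.swap) (simp add: sum_distrib_left)
    also have "\<dots> = (\<Sum>r | r \<in> S \<and> M r u \<noteq> 0. M r u * (\<Sum>v\<in>S - {u}. M r v))"
      using S by (intro sum.mono_neutral_right) auto
    also have "\<dots> \<le> (\<Sum>r | r \<in> S \<and> M r u \<noteq> 0. w * (\<Sum>v\<in>S - {u}. M r v))"
      by (intro sum_mono mult_right_mono le_w sum_nonneg M) auto
    finally show ?thesis by (simp add: sum_distrib_left)
  qed
  then have "(\<Sum>v\<in>S. cmod (P (P (basis_vec u)) v - complex_of_real (w\<^sup>2) * basis_vec u v)) / w
      \<le> (\<Sum>r | r \<in> S \<and> M r u \<noteq> 0. \<Sum>v\<in>S - {u}. M r v)"
    using w by (simp add: field_simps)
  ultimately show ?thesis using le_w[OF r0] by linarith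
qed

section \<open>Size of the Pascal weights\<close>

lemma central_binomial_Suc: "(2 * Suc n) choose Suc n = 2 * (Suc (2 * n) choose n)"
proof -
  define b d where "b = Suc (2 * n) choose n" and "d = (2 * Suc n) choose Suc n"
  have "Suc n * d = Suc (Suc (2 * n)) * b"
    using Suc_times_binomial[of n "Suc (2 * n)"] unfolding b_def d_def by (simp only: mult_Suc_right add_2_eq_Suc)
  also have "\<dots> = Suc n * (2 * b)" by simp
  finally show ?thesis unfolding b_def d_def by (metis Suc_neq_Zero mult_left_cancel)
qed

lemma central_binomial_ge:
  assumes "n \<ge> 1"
  shows "4 ^ n \<le> 2 * sqrt (real n) * real ((2 * n) choose n)"
proof -
  have "16 ^ n \<le> 4 * real n * (real ((2 * n) choose n))\<^sup>2"
    using assms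
  proof (induction n rule: dec_induct)
    case (step n)
    define c d where "c = real ((2 * n) choose n)" and "d = real ((2 * Suc n) choose Suc n)"
    have e: "(real n + 1) * d = 2 * (2 * real n + 1) * c"
    proof -
      have "(Suc (2 * n) - n) * (Suc (2 * n) choose n) = Suc (2 * n) * ((2 * n) choose n)"
        using binomial_absorb_comp[of "Suc (2 * n)" n] by simp
      then have "real ((Suc (2 * n) - n) * (Suc (2 * n) choose n)) = real (Suc (2 * n) * ((2 * n) choose n))"
        by (rule arg_cong)
      then have "(real n + 1) * real (Suc (2 * n) choose n) = (2 * real n + 1) * c"
        unfolding of_nat_mult c_def by (simp add: of_nat_diff add.commute)
      moreover have "d = 2 * real (Suc (2 * n) choose n)"
        unfolding d_def central_binomial_Suc by simp
      ultimately show ?thesis by (simp add: algebra_simps)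
    qed
    have "16 ^ Suc n * (real n + 1) \<le> 16 * (4 * real n * c\<^sup>2) * (real n + 1)"
      using step.IH unfolding c_def by (intro mult_right_mono) auto
    also have "\<dots> = 16 * c\<^sup>2 * (4 * real n * (real n + 1))" by simp
    also have "\<dots> \<le> 16 * c\<^sup>2 * (2 * real n + 1)\<^sup>2"
      by (intro mult_left_mono) (auto simp: power2_eq_square algebra_simps)
    also have "\<dots> = 4 * (2 * (2 * real n + 1) * c)\<^sup>2" by (simp add: power2_eq_square algebra_simps)
    also have "\<dots> = 4 * (real n + 1) * d\<^sup>2 * (real n + 1)"
      unfolding e[symmetric] by (simp add: power2_eq_square)
    finally have "16 ^ Suc n \<le> 4 * (real n + 1) * d\<^sup>2" by simp
    then show ?case by (simp add: d_def add.commute)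
  qed simp
  moreover have "(4 ^ n)\<^sup>2 = (16::real) ^ n" by (simp add: power2_eq_square flip: power_mult_distrib)
  moreover have "(2 * sqrt (real n) * real ((2 * n) choose n))\<^sup>2 = 4 * real n * (real ((2 * n) choose n))\<^sup>2"
    by (simp add: power_mult_distrib)
  ultimately have "(4 ^ n)\<^sup>2 \<le> (2 * sqrt (real n) * real ((2 * n) choose n))\<^sup>2" by simp
  then show ?thesis by (rule power2_le_imp_le) simp
qed

text \<open>
  This is a point probability of the binomial distribution with \<open>2 * r + u + 1\<close> fair trials.
\<close>

definition binom_weight :: "nat \<Rightarrow> nat \<Rightarrow> real" where
  "binom_weight r u = real ((2 * r + u + 1) choose r) / 2 ^ (2 * r + u + 1)"

lemma W_eq: "W r u = 1/2 * binom_weight r u * sqrt (real (r + u + 1) / real (r + 1))"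
  by (simp add: W_def binom_weight_def)

lemma binom_weight_0_ge: "1 / (2 * sqrt (real (n + 1))) \<le> binom_weight n 0"
proof -
  have "(2 * (n + 1)) choose (n + 1) = 2 * ((2 * n + 1) choose n)"
    using central_binomial_Suc[of n] by simp
  then have *: "binom_weight n 0 = real ((2 * (n + 1)) choose (n + 1)) / 4 ^ (n + 1)"
    by (simp only: of_nat_mult) (simp add: binom_weight_def power_mult)
  define c where "c = real ((2 * (n + 1)) choose (n + 1))"
  have "4 ^ (n + 1) \<le> 2 * sqrt (real (n + 1)) * c"
    unfolding c_def by (rule central_binomial_ge) simp
  then show ?thesis unfolding * c_def[symmetric] by (simp add: field_simps del: of_nat_add)
qed

lemma binom_weight_Suc:
  "binom_weight r (Suc u) = binom_weight (Suc r) u * (1 - (real u + 1) / real (2 * r + u + 3))"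
proof -
  define A B X where "A = real ((2 * r + u + 3) choose Suc r)"
    and "B = real ((2 * r + u + 2) choose r)" and "X = (2::real) ^ (2 * r + u + 2)"
  define d where "d = 2 * real r + real u + 3"
  have d: "d > 0" by (simp add: d_def)
  have X: "X > 0" by (simp add: X_def)
  have "Suc r * (Suc (2 * r + u + 2) choose Suc r) = Suc (2 * r + u + 2) * ((2 * r + u + 2) choose r)"
    by (rule Suc_times_binomial)
  then have "real (Suc r * (Suc (2 * r + u + 2) choose Suc r)) = real (Suc (2 * r + u + 2) * ((2 * r + u + 2) choose r))"
    by (rule arg_cong)
  moreover have "Suc (2 * r + u + 2) = 2 * r + u + 3" by simp
  ultimately have "real (Suc r) * A = real (2 * r + u + 3) * B"
    by (simp only: of_nat_mult A_def B_def)
  then have AB: "B = (real r + 1) * A / d" using d by (simp add: d_def field_simps)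
  have 1: "1 - (real u + 1) / real (2 * r + u + 3) = 2 * (real r + 1) / d"
    by (simp add: d_def field_simps)
  have 2: "binom_weight (Suc r) u = A / (2 * X)"
    by (simp add: binom_weight_def A_def X_def numeral_3_eq_3)
  have 3: "binom_weight r (Suc u) = B / X"
    by (simp add: binom_weight_def B_def X_def)
  show ?thesis unfolding 1 2 3 AB using d X by (simp add: field_simps)
qed

lemma binom_weight_nonneg: "0 \<le> binom_weight r u"
  by (simp add: binom_weight_def)

text \<open>
  Moving one step away from the centre along an antidiagonal loses a factor \<open>1 - y\<close> with \<open>y\<close> at most
  \<open>(u + 1) / n\<close>; the product of these factors is at least 1 minus the sum of the \<open>y\<close>.
\<close>

lemma binom_weight_ge:
  "binom_weight (r + u) 0 * (1 - real (u * (u + 1)) / (2 * real (r + u))) \<le> binom_weight r u"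
proof (induction u arbitrary: r)
  case (Suc u)
  define n where "n = real (r + Suc u)"
  define x y where "x = real (u * (u + 1)) / (2 * n)" and "y = (real u + 1) / n"
  have n: "n > 0" by (simp add: n_def)
  have xy: "x \<ge> 0" "y \<ge> 0" using n by (auto simp: x_def y_def)
  have "binom_weight (r + Suc u) 0 * (1 - real (Suc u * (Suc u + 1)) / (2 * real (r + Suc u)))
      = binom_weight (Suc r + u) 0 * (1 - x - y)"
  proof -
    have "real (Suc u * (Suc u + 1)) / (2 * n) = x + y"
      using n by (simp add: x_def y_def field_simps)
    then show ?thesis unfolding n_def[symmetric] by (simp add: algebra_simps)
  qed
  also have "\<dots> \<le> binom_weight (Suc r + u) 0 * ((1 - x) * (1 - y))"
    using xy by (intro mult_left_mono binom_weight_nonneg) (simp add: algebra_simps)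
  also have "\<dots> = binom_weight (Suc r + u) 0 * (1 - x) * (1 - y)" by simp
  also have "\<dots> \<le> binom_weight (Suc r) u * (1 - y)"
    using Suc[of "Suc r"] n by (intro mult_right_mono) (auto simp: x_def y_def n_def)
  also have "\<dots> \<le> binom_weight (Suc r) u * (1 - (real u + 1) / real (2 * r + u + 3))"
    unfolding y_def n_def by (intro mult_left_mono diff_mono divide_left_mono binom_weight_nonneg) auto
  also have "\<dots> = binom_weight r (Suc u)" by (rule binom_weight_Suc[symmetric])
  finally show ?case .
qed simp

lemma W_ge:
  assumes "u * (u + 1) \<le> r + u"
  shows "1 / (8 * sqrt (real (r + u + 1))) \<le> W r u"
proof -
  have "1 / (2 * sqrt (real (r + u + 1))) * (1 / 2)
      \<le> binom_weight (r + u) 0 * (1 - real (u * (u + 1)) / (2 * real (r + u)))"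
  proof (intro mult_mono binom_weight_0_ge binom_weight_nonneg)
    have "real (u * (u + 1)) \<le> real (r + u)" using assms by (rule of_nat_mono)
    then show "1 / 2 \<le> 1 - real (u * (u + 1)) / (2 * real (r + u))"
      by (cases "r + u = 0") (auto simp: field_simps)
  qed auto
  also have "\<dots> \<le> binom_weight r u" by (rule binom_weight_ge)
  finally have "1 / (8 * sqrt (real (r + u + 1))) \<le> 1/2 * binom_weight r u * 1" by simp
  also have "\<dots> \<le> W r u"
    unfolding W_eq by (intro mult_left_mono) (auto simp: binom_weight_nonneg)
  finally show ?thesis .
qed

text \<open>
  Binomial coefficients increase up to the middle, so each of the \<open>v + 2\<close> coefficients between position
  \<open>r\<close> and its mirror image is at least the one at \<open>r\<close>, and together they sum to at most \<open>2 ^ (2 * r + v + 1)\<close>.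
\<close>

lemma binom_weight_le: "binom_weight r v \<le> 1 / (real v + 2)"
proof -
  define L where "L = 2 * r + v + 1"
  have "(v + 2) * (L choose r) = (\<Sum>i\<in>{r..r+v+1}. L choose r)" by simp
  also have "\<dots> \<le> (\<Sum>i\<in>{r..r+v+1}. L choose i)"
  proof (rule sum_mono)
    fix i assume i: "i \<in> {r..r+v+1}"
    show "L choose r \<le> L choose i"
    proof (cases "2 * i \<le> L")
      case True then show ?thesis using i by (intro binomial_mono) auto
    next
      case False
      then have "L choose r \<le> L choose (L - i)" using i by (intro binomial_mono) (auto simp: L_def)
      also have "\<dots> = L choose i" using i by (intro binomial_symmetric[symmetric]) (auto simp: L_def)
      finally show ?thesis .
    qed
  qed
  also have "\<dots> \<le> (\<Sum>i\<le>L. L choose i)" by (intro sum_mono2) (auto simp: L_def)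
  also have "\<dots> = 2 ^ L" by (rule choose_row_sum)
  finally have "real ((v + 2) * (L choose r)) \<le> real (2 ^ L)" by (rule of_nat_mono)
  then show ?thesis by (simp add: binom_weight_def L_def field_simps)
qed

lemma W_le:
  assumes "r \<le> v"
  shows "W r v \<le> 1 / sqrt (real (r + v + 1))"
proof -
  have "W r v \<le> 1/2 * (1 / (real v + 2)) * sqrt (real (r + v + 1))"
    unfolding W_eq by (intro mult_mono binom_weight_le) (auto simp: binom_weight_nonneg field_simps)
  also have "\<dots> \<le> 1 / sqrt (real (r + v + 1))"
    using assms by (simp add: field_simps)
  finally show ?thesis .
qed

lemma W_nonneg: "0 \<le> W r u" by (simp add: W_def)

section \<open>A lacunary square-summable sequence\<close>

text \<open>
  The window of \<open>k\<close> is the set of columns \<open>u\<close> with \<open>width k \<le> u < 2 * width k\<close>, and \<open>node k\<close> is the square of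
  \<open>2 * width k\<close>, so that the window lies in the bulk of its antidiagonal. Squaring makes each node smaller
  than the next width. The factor \<open>96 * (k + 1)\<close> is what the interaction with later nodes requires: it is
  bounded by \<open>2 / width (k + 1)\<close>, and has to be at most half of the main term \<open>1 / (24 * (k + 1) * width k)\<close>.
\<close>

primrec width :: "nat \<Rightarrow> nat" where
  "width 0 = 1"
| "width (Suc k) = 96 * Suc k * (width k)\<^sup>2"

definition node :: "nat \<Rightarrow> nat" where "node k = 4 * (width k)\<^sup>2"

lemma width_pos: "1 \<le> width k"
  by (induction k) auto

lemma node_less_width_Suc: "node k < width (Suc k)"
proof -
  have "1 * (width k)\<^sup>2 \<le> Suc k * (width k)\<^sup>2" by (intro mult_le_mono) auto
  then have "96 * (width k)\<^sup>2 \<le> width (Suc k)" by (simp del: mult_Suc)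
  moreover have "0 < (width k)\<^sup>2" using width_pos[of k] by simp
  ultimately show ?thesis unfolding node_def by linarith
qed

lemma width_le_node: "4 * width k \<le> node k"
  using width_pos[of k] by (simp add: node_def power2_eq_square)

lemma width_strict_mono: "strict_mono width"
proof (rule strict_mono_Suc_iff[THEN iffD2], rule allI)
  show "width k < width (Suc k)" for k using node_less_width_Suc[of k] width_le_node[of k] by linarith
qed

lemma node_less_width: "j < k \<Longrightarrow> node j < width k"
  using node_less_width_Suc[of j] strict_mono_less_eq[OF width_strict_mono, of "Suc j" k] by (simp del: width.simps)

lemma node_strict_mono: "strict_mono node"
proof (rule strict_monoI)
  show "node j < node k" if "j < k" for j k
    using node_less_width[OF that] width_le_node[of k] by linarith
qed

definition spike :: "nat \<Rightarrow> real" where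
  "spike i = (if i \<in> range node then 1 / (real (inv node i) + 1) else 0)"

lemma spike_node: "spike (node k) = 1 / (real k + 1)"
  using strict_mono_imp_inj_on[OF node_strict_mono] by (simp add: spike_def)

lemma spike_nonneg: "0 \<le> spike i" and spike_le_1: "spike i \<le> 1"
  by (auto simp: spike_def)

lemma spike_ell2: "(\<lambda>i. complex_of_real (spike i)) \<in> ell2"
proof -
  have "summable (\<lambda>k. (spike (node k))\<^sup>2)"
  proof -
    have "summable (\<lambda>k. inverse (real (Suc k) ^ 2))"
      using inverse_power_summable[of 2, where 'a = real] summable_Suc_iff[of "\<lambda>n. inverse (real n ^ 2)"] by simp
    then show ?thesis by (simp add: spike_node power_divide inverse_eq_divide add.commute)
  qed
  then have "summable (\<lambda>i. (spike i)\<^sup>2)"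
    by (subst (asm) summable_mono_reindex[OF node_strict_mono]) (auto simp: spike_def)
  then show ?thesis by (simp add: ell2_def)
qed

lemma sum_le_sum_reindex:
  fixes g :: "'a \<Rightarrow> real"
  assumes "finite A" "finite I" "\<And>x. 0 \<le> g x" "\<And>x. x \<in> A \<Longrightarrow> g x \<noteq> 0 \<Longrightarrow> x \<in> h ` I"
  shows "sum g A \<le> (\<Sum>i\<in>I. g (h i))"
proof -
  have "sum g A = sum g {x \<in> A. g x \<noteq> 0}"
    using assms(1) by (intro sum.mono_neutral_right) auto
  also have "\<dots> \<le> sum g (h ` I)" using assms by (intro sum_mono2) auto
  also have "\<dots> \<le> sum (g \<circ> h) I" using assms by (intro sum_image_le) auto
  finally show ?thesis by simp
qed

lemma sum_inverse_width_le: "(\<Sum>l\<in>{j<..K}. 1 / real (width l)) \<le> 2 / real (width (Suc j))"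
proof -
  have dbl: "2 / real (width (Suc l)) \<le> 1 / real (width l)" for l
  proof -
    have "2 * width l \<le> width (Suc l)" using node_less_width_Suc[of l] width_le_node[of l] by linarith
    then have "real (2 * width l) \<le> real (width (Suc l))" by (rule of_nat_mono)
    then show ?thesis using width_pos[of l] width_pos[of "Suc l"] by (simp add: field_simps del: width.simps)
  qed
  have "(\<Sum>l\<in>{j<..K}. 1 / real (width l)) \<le> 2 / real (width (Suc j)) - 1 / real (width K)" if "Suc j \<le> K"
    using that
  proof (induction K rule: dec_induct)
    case base
    have "{j<..Suc j} = {Suc j}" by auto
    then show ?case by (simp del: width.simps)
  next
    case (step K)
    have "{j<..Suc K} = insert (Suc K) {j<..K}" using step by auto
    then show ?case using step.IH dbl[of K] by (simp del: width.simps)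
  qed
  moreover have "(\<Sum>l\<in>{j<..K}. 1 / real (width l)) \<le> 2 / real (width (Suc j))" if "\<not> Suc j \<le> K"
    using that by (simp del: width.simps)
  ultimately show ?thesis by (smt (verit) divide_nonneg_nonneg of_nat_0_le_iff)
qed

definition spike_hankel :: "nat \<Rightarrow> nat \<Rightarrow> real" where
  "spike_hankel r v = spike (r + v) * W r v"

lemma spike_hankel_nonneg: "0 \<le> spike_hankel r v" by (simp add: spike_hankel_def spike_nonneg W_nonneg)

text \<open>
  Two indices up to \<open>node K\<close> add up to less than \<open>node (K + 1)\<close>, so only the first nodes are visible in the block.
\<close>

lemma spike_hankel_nonzeroE:
  assumes "spike_hankel r v \<noteq> 0" "r \<le> node K" "v \<le> node K"
  obtains l where "l \<le> K" "r + v = node l"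
proof -
  obtain l where l: "r + v = node l" using assms(1) by (auto simp: spike_hankel_def spike_def split: if_splits)
  have "\<not> K < l"
    using node_less_width[of K l] width_le_node[of l] l assms by linarith
  then show ?thesis using that[OF _ l] by simp
qed

text \<open>
  The row \<open>node j - u\<close> meets the antidiagonal of \<open>node l\<close> in a column \<open>v \<noteq> u\<close> only for \<open>l > j\<close>, as it lies beyond
  all earlier nodes. There the column index exceeds the row index, and the weight is at most
  \<open>1 / sqrt (node l) = 1 / (2 * width l)\<close>.
\<close>

lemma row_sum_le:
  assumes u: "u < 2 * width j" and j: "j \<le> K"
  shows "(\<Sum>v\<in>{..node K} - {u}. spike_hankel (node j - u) v) \<le> 1 / real (width (Suc j))"
proof -
  define r where "r = node j - u"
  have uj: "u \<le> node j" using u width_le_node[of j] by linarith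
  have "(\<Sum>v\<in>{..node K} - {u}. spike_hankel r v) \<le> (\<Sum>l\<in>{j<..K}. spike_hankel r (node l - r))"
  proof (rule sum_le_sum_reindex)
    fix v assume v: "v \<in> {..node K} - {u}" "spike_hankel r v \<noteq> 0"
    have "r \<le> node K"
      using strict_mono_less_eq[OF node_strict_mono, of j K] j by (simp add: r_def)
    then obtain l where l: "l \<le> K" "r + v = node l" using spike_hankel_nonzeroE[of r v K] v by auto
    have "l \<noteq> j" using l v uj by (auto simp: r_def)
    moreover have "\<not> l < j"
      using node_less_width[of l j] l u width_le_node[of j] by (auto simp: r_def)
    ultimately show "v \<in> (\<lambda>l. node l - r) ` {j<..K}"
      using l by (intro image_eqI[of _ _ l]) auto
  qed (auto simp: spike_hankel_nonneg)
  also have "\<dots> \<le> (\<Sum>l\<in>{j<..K}. 1/2 * (1 / real (width l)))"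
  proof (rule sum_mono)
    fix l assume l: "l \<in> {j<..K}"
    define v where "v = node l - r"
    have rv: "r + v = node l" "r \<le> v"
      using node_less_width[of j l] width_le_node[of l] l by (auto simp: v_def r_def)
    have "spike_hankel r v \<le> 1 * W r v" unfolding spike_hankel_def
      by (intro mult_right_mono spike_le_1 W_nonneg)
    also have "\<dots> \<le> 1 / sqrt (real (r + v + 1))" using W_le[OF rv(2)] by simp
    also have "\<dots> \<le> 1 / sqrt ((2 * real (width l))\<^sup>2)"
      using width_pos[of l] unfolding rv
      by (intro frac_le real_sqrt_le_mono) (auto simp: node_def power_mult_distrib)
    also have "\<dots> = 1/2 * (1 / real (width l))" by (simp only: real_sqrt_abs)
    finally show "spike_hankel r (node l - r) \<le> 1/2 * (1 / real (width l))" by (simp add: v_def)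
  qed
  also have "\<dots> \<le> 1 / real (width (Suc j))"
    using sum_inverse_width_le[of j K] unfolding sum_distrib_left[symmetric] by simp
  finally show ?thesis by (simp add: r_def)
qed

text \<open>
  The main term is the entry of column \<open>u\<close> on the antidiagonal \<open>node k\<close>. Column \<open>u\<close> misses the antidiagonals
  of earlier nodes, which are smaller than \<open>u\<close>, so the rows that it meets belong to nodes \<open>j \<ge> k\<close>.
\<close>

lemma abs_op_diagonal_window:
  assumes k: "k \<le> K" and u: "width k \<le> u" "u < 2 * width k"
    and P: "is_abs_op (block_op (\<lambda>r v. complex_of_real (spike_hankel r v)) {..node K} {..node K}) P"
  shows "1 / (48 * (real k + 1) * real (width k)) \<le> Re (P (basis_vec u) u)"
proof -
  have pos: "real (width k) \<ge> 1" using width_pos[of k] by simp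
  have uk: "u \<le> node k" using u width_le_node[of k] by linarith
  have kK: "node k \<le> node K" using k strict_mono_less_eq[OF node_strict_mono] by blast
  define r0 where "r0 = node k - u"
  have r0: "r0 + u = node k" using uk by (simp add: r0_def)
  have lower: "1 / (24 * (real k + 1) * real (width k)) \<le> spike_hankel r0 u"
  proof -
    have "u * (u + 1) \<le> (2 * width k) * (2 * width k)" using u by (intro mult_le_mono) auto
    also have "\<dots> = r0 + u" by (simp add: r0 node_def power2_eq_square)
    finally have W: "1 / (8 * sqrt (real (r0 + u + 1))) \<le> W r0 u" by (rule W_ge)
    have "real (r0 + u + 1) = 4 * (real (width k))\<^sup>2 + 1" unfolding r0 by (simp add: node_def)
    also have "\<dots> \<le> (3 * real (width k))\<^sup>2"
      using one_le_power[OF pos, of 2] unfolding power_mult_distrib by simp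
    finally have "sqrt (real (r0 + u + 1)) \<le> sqrt ((3 * real (width k))\<^sup>2)"
      by (rule real_sqrt_le_mono)
    also have "\<dots> = 3 * real (width k)" by (simp only: real_sqrt_abs)
    finally have "sqrt (real (r0 + u + 1)) \<le> 3 * real (width k)" .
    then have "1 / (8 * (3 * real (width k))) \<le> 1 / (8 * sqrt (real (r0 + u + 1)))"
      using pos by (intro divide_left_mono mult_left_mono mult_pos_pos) auto
    with W have "1 / (real k + 1) * (1 / (8 * (3 * real (width k)))) \<le> 1 / (real k + 1) * W r0 u"
      by (intro mult_left_mono) auto
    then show ?thesis by (simp add: spike_hankel_def r0 spike_node mult_ac)
  qed
  have "(\<Sum>r | r \<in> {..node K} \<and> spike_hankel r u \<noteq> 0. \<Sum>v\<in>{..node K} - {u}. spike_hankel r v)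
     \<le> (\<Sum>j\<in>{k..K}. \<Sum>v\<in>{..node K} - {u}. spike_hankel (node j - u) v)"
  proof (rule sum_le_sum_reindex)
    fix r assume "r \<in> {r. r \<in> {..node K} \<and> spike_hankel r u \<noteq> 0}"
    then obtain j where j: "j \<le> K" "r + u = node j" using spike_hankel_nonzeroE[of r u K] uk kK by auto
    have "\<not> j < k" using node_less_width[of j k] j u by linarith
    then show "r \<in> (\<lambda>j. node j - u) ` {k..K}" using j by (intro image_eqI[of _ _ j]) auto
  qed (auto intro!: sum_nonneg spike_hankel_nonneg)
  also have "\<dots> \<le> (\<Sum>j\<in>{k..K}. 1 / real (width (Suc j)))"
  proof (intro sum_mono row_sum_le)
    fix j assume "j \<in> {k..K}"
    then have "width k \<le> width j" using strict_mono_less_eq[OF width_strict_mono] by auto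
    then show "u < 2 * width j" using u by linarith
  qed auto
  also have "\<dots> = (\<Sum>l\<in>{k<..Suc K}. 1 / real (width l))"
    by (rule sum.reindex_bij_witness[of _ "\<lambda>l. l - 1" Suc]) (auto simp del: width.simps)
  also have "\<dots> \<le> 2 / real (width (Suc k))" by (rule sum_inverse_width_le)
  also have "real (width (Suc k)) = 2 * (48 * (real k + 1) * (real (width k))\<^sup>2)"
    by (simp add: algebra_simps)
  also have "2 / \<dots> = 1 / (48 * (real k + 1) * (real (width k))\<^sup>2)" by simp
  also have "\<dots> \<le> 1 / (48 * (real k + 1) * real (width k))"
    using pos by (intro divide_left_mono mult_left_mono mult_pos_pos) (auto simp: power2_eq_square)
  finally have upper: "(\<Sum>r | r \<in> {..node K} \<and> spike_hankel r u \<noteq> 0. \<Sum>v\<in>{..node K} - {u}. spike_hankel r v)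
      \<le> 1 / (48 * (real k + 1) * real (width k))" .
  have diag: "spike_hankel r0 u - (\<Sum>r | r \<in> {..node K} \<and> spike_hankel r u \<noteq> 0. \<Sum>v\<in>{..node K} - {u}. spike_hankel r v)
      \<le> Re (P (basis_vec u) u)"
    using uk kK by (intro abs_op_diagonal_ge P spike_hankel_nonneg) (auto simp: r0_def)
  define q where "q = 1 / (48 * (real k + 1) * real (width k))"
  have "1 / c = 2 * (1 / (2 * c))" for c :: real by simp
  moreover have "48 * (real k + 1) * real (width k) = 2 * (24 * (real k + 1) * real (width k))" by simp
  ultimately have "1 / (24 * (real k + 1) * real (width k)) = 2 * q" unfolding q_def by metis
  then have "2 * q \<le> spike_hankel r0 u" using lower by simp
  with upper diag show ?thesis unfolding q_def[symmetric] by linarith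
qed

text \<open>
  The number of columns in the window of \<open>k\<close> cancels the factor \<open>width k\<close> in the bound for a single column,
  and disjointness of the windows lets the contributions of different \<open>k\<close> add up.
\<close>

lemma trace_norm_block_ge:
  "ennreal (\<Sum>k\<le>K. 1 / (48 * (real k + 1)))
    \<le> trace_norm (block_op (\<lambda>r v. complex_of_real (spike_hankel r v)) {..node K} {..node K})"
proof -
  define T where "T = block_op (\<lambda>r v. complex_of_real (spike_hankel r v)) {..node K} {..node K}"
  define d where "d = (\<lambda>u. Re (abs_op T (basis_vec u) u))"
  have abs: "is_abs_op T (abs_op T)" unfolding T_def by (rule is_abs_op_block_op) simp
  have win: "1 / (48 * (real k + 1) * real (width k)) \<le> d u" if "k \<le> K" "u \<in> {width k..<2 * width k}" for k u
    using abs_op_diagonal_window[OF that(1), of u "abs_op T"] that abs unfolding d_def T_def by auto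
  define U where "U = (\<Union>k\<le>K. {width k..<2 * width k})"
  have disj: "{width i..<2 * width i} \<inter> {width j..<2 * width j} = {}" if "i < j" for i j
    using node_less_width[OF that] width_le_node[of i] by auto
  have d0: "0 \<le> d u" for u
  proof -
    have "ell2_inner (abs_op T (basis_vec u)) (basis_vec u) \<in> \<real>\<^sub>\<ge>\<^sub>0"
      using abs basis_vec_ell2 unfolding is_abs_op_def positive_op_def by blast
    then show ?thesis by (simp add: d_def complex_nonneg_Reals_iff)
  qed
  have "(\<Sum>k\<le>K. 1 / (48 * (real k + 1))) = (\<Sum>k\<le>K. \<Sum>u\<in>{width k..<2 * width k}. 1 / (48 * (real k + 1) * real (width k)))"
    using width_pos by (intro sum.cong) (auto simp: Suc_le_eq)
  also have "\<dots> \<le> (\<Sum>k\<le>K. \<Sum>u\<in>{width k..<2 * width k}. d u)"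
    by (intro sum_mono win) auto
  also have "\<dots> = (\<Sum>u\<in>U. d u)"
    unfolding U_def using disj
    by (subst sum.UNION_disjoint) (auto, metis disjoint_iff nat_neq_iff atLeastLessThan_iff)
  finally have "ennreal (\<Sum>k\<le>K. 1 / (48 * (real k + 1))) \<le> ennreal (\<Sum>u\<in>U. d u)"
    by (rule ennreal_leI)
  also have "\<dots> = (\<Sum>u\<in>U. ennreal (d u))" by (rule sum_ennreal[symmetric]) (rule d0)
  also have "\<dots> \<le> (\<Sum>u. ennreal (d u))" by (intro sum_le_suminf) (auto simp: U_def)
  finally show ?thesis by (simp add: trace_norm_def T_def d_def)
qed

lemma harmonic_unbounded: "\<exists>K. c < (\<Sum>k\<le>K. 1 / (48 * (real k + 1)))"
proof -
  have "\<not> summable (\<lambda>k. 1 / (48 * (real k + 1)))"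
  proof
    assume "summable (\<lambda>k. 1 / (48 * (real k + 1)))"
    then have "summable (\<lambda>k. 48 * (1 / (48 * (real k + 1))))" by (rule summable_mult)
    also have "(\<lambda>k. 48 * (1 / (48 * (real k + 1)))) = (\<lambda>k. inverse (real (Suc k)))"
      by (auto simp: fun_eq_iff field_simps)
    finally have "summable (\<lambda>k. inverse (real (Suc k)))" .
    then have "summable (\<lambda>k. inverse (real k))" by (simp only: summable_Suc_iff[of "\<lambda>k. inverse (real k)"])
    then show False using not_summable_harmonic by blast
  qed
  then show ?thesis
    using bounded_imp_summable[of "\<lambda>k. 1 / (48 * (real k + 1))" c] by (force simp: not_le)
qed

text \<open>
  Matrix entries determine a bounded operator on finitely supported sequences, and the images of the tails
  of \<open>x\<close> tend to zero by boundedness.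
\<close>

lemma bounded_op_eq_block_op:
  assumes T: "bounded_op T" and S: "finite S"
    and entries: "\<And>r u. op_entry T r u = (if r \<in> S \<and> u \<in> S then N r u else 0)"
    and x: "x \<in> ell2"
  shows "T x = block_op N S S x"
proof
  fix r
  have add: "T (\<lambda>n. x n + y n) = (\<lambda>n. T x n + T y n)" if "x \<in> ell2" "y \<in> ell2" for x y
    using T that unfolding bounded_op_def by blast
  have scale: "T (\<lambda>n. c * y n) = (\<lambda>n. c * T y n)" if "y \<in> ell2" for c y
    using T that unfolding bounded_op_def by blast
  have Tell: "T y \<in> ell2" if "y \<in> ell2" for y using T that unfolding bounded_op_def by blast
  obtain C where C: "C \<ge> 0" "\<And>y. y \<in> ell2 \<Longrightarrow> ell2_norm (T y) \<le> C * ell2_norm y"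
    using T unfolding bounded_op_def by blast
  have Te: "T (basis_vec u) r = (if r \<in> S \<and> u \<in> S then N r u else 0)" for u
    using entries[of r u] by (simp add: op_entry_def)
  define tail where "tail = (\<lambda>m n. if n < m then 0 else x n)"
  have tail: "tail m \<in> ell2" for m
  proof -
    have "summable (\<lambda>n. (cmod (x n))\<^sup>2)" using x by (simp add: ell2_def)
    then have "summable (\<lambda>n. (cmod (tail m n))\<^sup>2)"
      by (rule summable_comparison_test'[where N = 0]) (auto simp: tail_def)
    then show ?thesis by (simp add: ell2_def)
  qed
  have split: "T x r = (\<Sum>u<m. x u * T (basis_vec u) r) + T (tail m) r" for m
  proof (induction m)
    case 0
    have "tail 0 = x" by (simp add: tail_def)
    then show ?case by simp
  next
    case (Suc m)
    have "tail m = (\<lambda>n. x m * basis_vec m n + tail (Suc m) n)"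
      by (auto simp: tail_def basis_vec_def fun_eq_iff less_Suc_eq)
    then have "T (tail m) = (\<lambda>n. x m * T (basis_vec m) n + T (tail (Suc m)) n)"
      using add[OF ell2_scale[OF basis_vec_ell2] tail] scale[OF basis_vec_ell2] by simp
    then show ?case using Suc by simp
  qed
  have "(\<lambda>m. ell2_norm (tail m)) \<longlonglongrightarrow> 0"
  proof -
    have s: "summable (\<lambda>n. (cmod (x n))\<^sup>2)" using x by (simp add: ell2_def)
    have "(\<Sum>n. (cmod (tail m n))\<^sup>2) = (\<Sum>n. (cmod (x (n + m)))\<^sup>2)" for m
    proof -
      have "(\<Sum>n. (cmod (tail m n))\<^sup>2) = (\<Sum>n. (cmod (tail m (n + m)))\<^sup>2) + (\<Sum>n<m. (cmod (tail m n))\<^sup>2)"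
        using tail[of m] by (intro suminf_split_initial_segment) (simp add: ell2_def)
      then show ?thesis by (simp add: tail_def)
    qed
    moreover have "(\<lambda>m. \<Sum>n. (cmod (x (n + m)))\<^sup>2) \<longlonglongrightarrow> 0"
    proof -
      have "(\<lambda>m. (\<Sum>n. (cmod (x n))\<^sup>2) - (\<Sum>n<m. (cmod (x n))\<^sup>2)) \<longlonglongrightarrow> (\<Sum>n. (cmod (x n))\<^sup>2) - (\<Sum>n. (cmod (x n))\<^sup>2)"
        by (intro tendsto_intros summable_LIMSEQ s)
      then show ?thesis by (simp add: suminf_minus_initial_segment[OF s])
    qed
    ultimately show ?thesis using tendsto_real_sqrt by (fastforce simp: ell2_norm_def)
  qed
  then have "(\<lambda>m. C * ell2_norm (tail m)) \<longlonglongrightarrow> 0" by (rule tendsto_mult_right_zero)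
  then have "(\<lambda>m. T (tail m) r) \<longlonglongrightarrow> 0"
    by (rule Lim_null_comparison[rotated])
      (auto intro!: always_eventually order_trans[OF ell2_coord_le[OF Tell[OF tail]] C(2)[OF tail]])
  moreover have "eventually (\<lambda>m. T (tail m) r = T x r - block_op N S S x r) sequentially"
  proof -
    obtain m0 where m0: "S \<subseteq> {..<m0}" using S finite_nat_iff_bounded by blast
    have "T (tail m) r = T x r - block_op N S S x r" if "m \<ge> m0" for m
    proof -
      have "(\<Sum>u<m. x u * T (basis_vec u) r) = (\<Sum>u\<in>S. x u * T (basis_vec u) r)"
        using m0 that by (intro sum.mono_neutral_right) (auto simp: Te)
      also have "\<dots> = block_op N S S x r" by (auto simp: block_op_def Te mult.commute)
      finally show ?thesis using split[of m] by simp
    qed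
    then show ?thesis by (auto simp: eventually_sequentially)
  qed
  ultimately have "(\<lambda>m. T x r - block_op N S S x r) \<longlonglongrightarrow> 0"
    using tendsto_cong by fast
  then show "T x r = block_op N S S x r" by (simp add: LIMSEQ_const_iff)
qed

lemma trace_norm_cong:
  assumes "\<And>x. x \<in> ell2 \<Longrightarrow> T x = T' x"
  shows "trace_norm T = trace_norm T'"
proof -
  have "is_abs_op T P = is_abs_op T' P" for P by (simp add: is_abs_op_def assms)
  then have "is_abs_op T = is_abs_op T'" by blast
  then show ?thesis by (simp add: trace_norm_def abs_op_def)
qed

theorem theorem3p1:
  shows "(\<exists>a\<in>ell2.
            (SUP (I, U) \<in> {(I, U). finite I \<and> finite U}.
               trace_norm (block_op (pascal_hankel a) I U)) = \<infinity>) \<and>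
         \<not> (\<exists>\<Phi>. bounded_linear_into_trace_class \<Phi> \<and>
              (\<forall>a\<in>ell2. \<forall>r u. op_entry (\<Phi> a) r u = pascal_hankel a r u))"
proof
  define a where "a = (\<lambda>i. complex_of_real (spike i))"
  have a: "a \<in> ell2" unfolding a_def by (rule spike_ell2)
  have pa: "pascal_hankel a = (\<lambda>r v. complex_of_real (spike_hankel r v))"
    by (simp add: pascal_hankel_def a_def spike_hankel_def fun_eq_iff)
  show "\<exists>a\<in>ell2. (SUP (I, U) \<in> {(I, U). finite I \<and> finite U}.
               trace_norm (block_op (pascal_hankel a) I U)) = \<infinity>"
  proof (rule bexI[OF _ a], rule ccontr)
    let ?s = "SUP (I, U) \<in> {(I, U). finite I \<and> finite U}. trace_norm (block_op (pascal_hankel a) I U)"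
    assume "?s \<noteq> \<infinity>"
    then obtain c where c: "c \<ge> 0" "?s = ennreal c" by (cases ?s) auto
    obtain K where K: "c < (\<Sum>k\<le>K. 1 / (48 * (real k + 1)))" using harmonic_unbounded by blast
    have "ennreal (\<Sum>k\<le>K. 1 / (48 * (real k + 1))) \<le> trace_norm (block_op (pascal_hankel a) {..node K} {..node K})"
      unfolding pa by (rule trace_norm_block_ge)
    also have "\<dots> \<le> ?s" by (rule SUP_upper2[of "({..node K}, {..node K})"]) auto
    finally show False using K c by (simp add: ennreal_le_iff)
  qed
  show "\<not> (\<exists>\<Phi>. bounded_linear_into_trace_class \<Phi> \<and>
              (\<forall>a\<in>ell2. \<forall>r u. op_entry (\<Phi> a) r u = pascal_hankel a r u))"
  proof
    assume "\<exists>\<Phi>. bounded_linear_into_trace_class \<Phi> \<and>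
              (\<forall>a\<in>ell2. \<forall>r u. op_entry (\<Phi> a) r u = pascal_hankel a r u)"
    then obtain \<Phi> where lin: "bounded_linear_into_trace_class \<Phi>"
      and entry: "\<And>b r u. b \<in> ell2 \<Longrightarrow> op_entry (\<Phi> b) r u = pascal_hankel b r u" by blast
    have tc: "\<And>b. b \<in> ell2 \<Longrightarrow> \<Phi> b \<in> trace_class"
      using lin unfolding bounded_linear_into_trace_class_def by blast
    obtain C where C: "C \<ge> 0" "\<And>b. b \<in> ell2 \<Longrightarrow> trace_norm (\<Phi> b) \<le> ennreal (C * ell2_norm b)"
      using lin unfolding bounded_linear_into_trace_class_def by blast
    obtain K where K: "C * ell2_norm a < (\<Sum>k\<le>K. 1 / (48 * (real k + 1)))"
      using harmonic_unbounded by blast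
    \<comment> \<open>The cut-off has the same block up to \<open>node K\<close>, and all its other entries vanish.\<close>
    define b where "b = (\<lambda>i. if i \<le> node K then a i else 0)"
    have b: "b \<in> ell2" by (rule fin_supp_ell2[of "{..node K}"]) (auto simp: b_def)
    have "ell2_norm b \<le> ell2_norm a"
      unfolding ell2_norm_def using a b
      by (intro real_sqrt_le_mono suminf_le) (auto simp: ell2_def b_def)
    have ent: "op_entry (\<Phi> b) r u =
       (if r \<in> {..node K} \<and> u \<in> {..node K} then complex_of_real (spike_hankel r u) else 0)" for r u
    proof -
      have "op_entry (\<Phi> b) r u = b (r + u) * complex_of_real (W r u)"
        unfolding entry[OF b] pascal_hankel_def ..
      moreover have "spike_hankel r u = 0" if "r \<le> node K" "u \<le> node K" "\<not> r + u \<le> node K"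
      proof (rule ccontr)
        assume "spike_hankel r u \<noteq> 0"
        then obtain l where "l \<le> K" "r + u = node l" using spike_hankel_nonzeroE[of r u K] \<open>r \<le> node K\<close> \<open>u \<le> node K\<close> by blast
        then show False using \<open>\<not> r + u \<le> node K\<close> strict_mono_less_eq[OF node_strict_mono, of l K] by simp
      qed
      ultimately show ?thesis by (auto simp: b_def a_def spike_hankel_def)
    qed
    have "bounded_op (\<Phi> b)" using tc[OF b] by (simp add: trace_class_def)
    then have "trace_norm (\<Phi> b) = trace_norm (block_op (\<lambda>r v. complex_of_real (spike_hankel r v)) {..node K} {..node K})"
      by (intro trace_norm_cong bounded_op_eq_block_op ent) auto
    then have "ennreal (\<Sum>k\<le>K. 1 / (48 * (real k + 1))) \<le> ennreal (C * ell2_norm b)"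
      using trace_norm_block_ge[of K] C(2)[OF b] by (metis order_trans)
    then have "(\<Sum>k\<le>K. 1 / (48 * (real k + 1))) \<le> C * ell2_norm b"
      using C(1) ell2_norm_nonneg[OF b] by (subst (asm) ennreal_le_iff) auto
    also have "\<dots> \<le> C * ell2_norm a" using C(1) \<open>ell2_norm b \<le> ell2_norm a\<close> by (rule mult_left_mono[rotated])
    finally show False using K by simp
  qed
qed

end
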